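(* Let $\varpi:\mathbb{R}^3\to\mathbb{R}_+$ be measurable and $r\in[1,2]$. Denote $$\Lambda(\lambda):=\begin{cases}2&\text{if }\lambda=1,\\ \dfrac{(\lambda-1)^2}{\lambda\log\lambda-\lambda+1}&\text{if }\lambda\in\mathbb{R}_+\setminus\{1\}.\end{cases}$$ (1) For any $0\le f\in L^1_2(\mathbb{R}^3)\cap L\log L(\mathbb{R}^3)\setminus\{0\}$, assuming that the norms below are finite, $$\|(f-M)\,\varpi\|_{L^r}^2\le\left\|M\,\varpi^2\right\|_{L^{\frac r{2-r}}}\ \Lambda\left(\frac{\left\|f\,\varpi^2\right\|_{L^{\frac r{2-r}}}}{\left\|M\,\varpi^2\right\|_{L^{\frac r{2-r}}}}\right)H_0[f|M],$$ where $M\equiv M^f$ is the Maxwellian distribution associated with $f$. (2) For any $\varepsilon>0$ and $0\le f\in L^1_2(\mathbb{R}^3)\setminus\{0\}$ such that $1-\varepsilon f\ge0$ and $\gamma>\frac25$, assuming that the norms below are finite, $$\|(f-\mathcal{M})\,\varpi\|_{L^r}^2\le\left\|\mathcal{M}\,\varpi^2\right\|_{L^{\frac r{2-r}}}\ \Lambda\left(\frac{\left\|f\,\varpi^2\right\|_{L^{\frac r{2-r}}}}{\left\|\mathcal{M}\,\varpi^2\right\|_{L^{\frac r{2-r}}}}\right)H_\varepsilon[f|\mathcal{M}],$$ where $\mathcal{M}\equiv\mathcal{M}_\varepsilon^f$ is the $\varepsilon$-Fermi-Dirac distribution associated with $f$.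
   Context: When $r=2$, $L^{\frac r{2-r}}$ is understood as $L^\infty$; $0\log0=0$. $L^1_2(\mathbb{R}^3)$: measurable $g$ with $\int|g|(1+|v|^2)\,dv<\infty$. $L\log L(\mathbb{R}^3)$: measurable $g$ with $g\log|g|$ integrable. Moments: for nonnegative $f\in L^1_2(\mathbb{R}^3)\setminus\{0\}$, $(\rho,u,T)\in(0,\infty)\times\mathbb{R}^3\times(0,\infty)$ are defined by $\int f\,dv=\rho$, $\int f v\,dv=\rho u$, $\int f|v|^2\,dv=3\rho T+\rho|u|^2$. For $\varepsilon>0$: $T_F(\rho,\varepsilon)=\frac12\left(\frac{3\varepsilon\rho}{4\pi}\right)^{2/3}$ and $\gamma=T/T_F(\rho,\varepsilon)$. Equilibria: for $\varepsilon\ge0$, an $\varepsilon$-Fermi-Dirac distribution (Maxwellian if $\varepsilon=0$) is a function $v\mapsto \frac{e^{a+b|v-\bar u|^2}}{1+\varepsilon e^{a+b|v-\bar u|^2}}$ with $a\in\mathbb{R}$, $\bar u\in\mathbb{R}^3$, $b<0$. $\mathcal{M}_\varepsilon^f$ denotes the unique $\varepsilon$-Fermi-Dirac distribution having the same integrals against $1$, $v$, $|v|^2$ as $f$ (known to exist for $\varepsilon>0$ when $1-\varepsilon f\ge0$ and $\gamma>\frac25$). $M^f:=\mathcal{M}_0^f$. Entropy: $\varphi_\varepsilon(x)=\frac{x}{1-\varepsilon x}$, $\Phi_\varepsilon(x)=\int_0^x\log\varphi_\varepsilon(y)\,dy$ for $x\ge0$ with $1-\varepsilon x\ge0$ (so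 $\Phi_0(x)=x\log x-x$); $H_\varepsilon(f)=\int_{\mathbb{R}^3}\Phi_\varepsilon(f)\,dv$; $H_\varepsilon[f|g]=H_\varepsilon(f)-H_\varepsilon(g)$. *)

theory Defs
  imports "HOL-Analysis.Analysis" "HOL-Probability.Essential_Supremum"
begin

text \<open>The norm is real-valued; its finiteness is expressed by membership in \<open>Lp_space\<close>.\<close>

definition Lp_space :: "ennreal \<Rightarrow> 'a measure \<Rightarrow> ('a \<Rightarrow> real) set" where
  "Lp_space p M = {g \<in> borel_measurable M.
     if p = \<infinity> then esssup M (\<lambda>x. ennreal \<bar>g x\<bar>) < \<infinity>
     else integrable M (\<lambda>x. \<bar>g x\<bar> powr enn2real p)}"

definition Lp_norm :: "ennreal \<Rightarrow> 'a measure \<Rightarrow> ('a \<Rightarrow> real) \<Rightarrow> real" where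
  "Lp_norm p M g =
     (if p = \<infinity> then enn2real (esssup M (\<lambda>x. ennreal \<bar>g x\<bar>))
      else (\<integral>x. \<bar>g x\<bar> powr enn2real p \<partial>M) powr (1 / enn2real p))"

definition weight_exponent :: "real \<Rightarrow> ennreal" where
  "weight_exponent r = (if r = 2 then \<infinity> else ennreal (r / (2 - r)))"

definition L1_2 :: "(real^3 \<Rightarrow> real) set" where
  "L1_2 = {g \<in> borel_measurable lebesgue.
     integrable lebesgue (\<lambda>v. \<bar>g v\<bar> * (1 + (norm v)\<^sup>2))}"

text \<open>The convention \<open>0 log 0 = 0\<close> is automatic, here and below, because \<open>ln 0 = 0\<close>.\<close>

definition LlogL :: "(real^3 \<Rightarrow> real) set" where
  "LlogL = {g \<in> borel_measurable lebesgue.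
     integrable lebesgue (\<lambda>v. g v * ln \<bar>g v\<bar>)}"

definition mass_density :: "(real^3 \<Rightarrow> real) \<Rightarrow> real" where
  "mass_density f = (\<integral>v. f v \<partial>lebesgue)"

definition mean_velocity :: "(real^3 \<Rightarrow> real) \<Rightarrow> real^3" where
  "mean_velocity f = (1 / mass_density f) *\<^sub>R (\<integral>v. f v *\<^sub>R v \<partial>lebesgue)"

definition temperature :: "(real^3 \<Rightarrow> real) \<Rightarrow> real" where
  "temperature f =
     ((\<integral>v. f v * (norm v)\<^sup>2 \<partial>lebesgue) - mass_density f * (norm (mean_velocity f))\<^sup>2)
       / (3 * mass_density f)"

lemma moment_equations:
  assumes "mass_density f \<noteq> 0"
  shows "(\<integral>v. f v *\<^sub>R v \<partial>lebesgue) = mass_density f *\<^sub>R mean_velocity f"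
    and "(\<integral>v. f v * (norm v)\<^sup>2 \<partial>lebesgue) =
           3 * mass_density f * temperature f + mass_density f * (norm (mean_velocity f))\<^sup>2"
  using assms by (simp_all add: mean_velocity_def temperature_def)

definition fermi_temperature :: "real \<Rightarrow> real \<Rightarrow> real" where
  "fermi_temperature \<rho> \<epsilon> = 1 / 2 * (3 * \<epsilon> * \<rho> / (4 * pi)) powr (2 / 3)"

definition temperature_ratio :: "real \<Rightarrow> (real^3 \<Rightarrow> real) \<Rightarrow> real" where
  "temperature_ratio \<epsilon> f = temperature f / fermi_temperature (mass_density f) \<epsilon>"

definition fermi_dirac :: "real \<Rightarrow> (real^3 \<Rightarrow> real) \<Rightarrow> bool" where
  "fermi_dirac \<epsilon> g \<longleftrightarrow> (\<exists>a u b. b < 0 \<and>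
     g = (\<lambda>v. exp (a + b * (norm (v - u))\<^sup>2) / (1 + \<epsilon> * exp (a + b * (norm (v - u))\<^sup>2))))"

definition same_moments :: "(real^3 \<Rightarrow> real) \<Rightarrow> (real^3 \<Rightarrow> real) \<Rightarrow> bool" where
  "same_moments f g \<longleftrightarrow>
     (\<integral>v. g v \<partial>lebesgue) = (\<integral>v. f v \<partial>lebesgue) \<and>
     (\<integral>v. g v *\<^sub>R v \<partial>lebesgue) = (\<integral>v. f v *\<^sub>R v \<partial>lebesgue) \<and>
     (\<integral>v. g v * (norm v)\<^sup>2 \<partial>lebesgue) = (\<integral>v. f v * (norm v)\<^sup>2 \<partial>lebesgue)"

text \<open>Existence and uniqueness of the function described here hold for \<open>\<epsilon> = 0\<close>, and for \<open>\<epsilon> > 0\<close>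
  under \<open>1 - \<epsilon> f \<ge> 0\<close> and \<open>temperature_ratio \<epsilon> f > 2/5\<close>; otherwise the value is unspecified.\<close>

definition equilibrium :: "real \<Rightarrow> (real^3 \<Rightarrow> real) \<Rightarrow> (real^3 \<Rightarrow> real)" where
  "equilibrium \<epsilon> f = (THE g. fermi_dirac \<epsilon> g \<and> same_moments f g)"

abbreviation maxwellian :: "(real^3 \<Rightarrow> real) \<Rightarrow> (real^3 \<Rightarrow> real)" where
  "maxwellian f \<equiv> equilibrium 0 f"

definition phi :: "real \<Rightarrow> real \<Rightarrow> real" where
  "phi \<epsilon> x = x / (1 - \<epsilon> * x)"

text \<open>Meaningful for \<open>0 \<le> x\<close> and \<open>\<epsilon> x \<le> 1\<close>; the integrand has at most logarithmic singularities
  at the end points \<open>0\<close> and \<open>1/\<epsilon>\<close>.\<close>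

definition Phi :: "real \<Rightarrow> real \<Rightarrow> real" where
  "Phi \<epsilon> x = integral {0..x} (\<lambda>y. ln (phi \<epsilon> y))"

definition quantum_entropy :: "real \<Rightarrow> (real^3 \<Rightarrow> real) \<Rightarrow> real" where
  "quantum_entropy \<epsilon> f = (\<integral>v. Phi \<epsilon> (f v) \<partial>lebesgue)"

definition relative_entropy :: "real \<Rightarrow> (real^3 \<Rightarrow> real) \<Rightarrow> (real^3 \<Rightarrow> real) \<Rightarrow> real" where
  "relative_entropy \<epsilon> f g = quantum_entropy \<epsilon> f - quantum_entropy \<epsilon> g"

definition Lambda :: "real \<Rightarrow> real" where
  "Lambda l = (if l = 1 then 2 else (l - 1)\<^sup>2 / (l * ln l - l + 1))"

end

theory Submission
  imports Defs "HOL-Real_Asymp.Real_Asymp" "HOL-Probability.Distributions"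
begin

text \<open>
  The inequality is a weighted Pinsker inequality.  Put
  \<open>h(x) = x ln x - x + 1\<close>, so that \<open>Lambda x = (x - 1)\<^sup>2 / h x\<close>.  The pointwise identity
  \<open>(f - M)\<^sup>2 = M \<Lambda>(f/M) (f ln (f/M) - f + M)\<close> reduces everything to one fact: \<open>Lambda\<close> is
  concave.  Indeed, if \<open>\<alpha> + \<beta> x\<close> is the line that supports \<open>Lambda\<close> at the quotient \<open>\<lambda> = B/A\<close> of
  the two weighted norms, then \<open>(f - M)\<^sup>2 \<le> (\<alpha> M + \<beta> f) (f ln (f/M) - f + M)\<close>, and the
  inequalities of Cauchy-Schwarz and Hoelder bound the square of the norm of \<open>(f - M) \<omega>\<close> by
  \<open>\<alpha> A + \<beta> B = A \<Lambda>(\<lambda>)\<close> times the integral of \<open>f ln (f/M) - f + M\<close>.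
  At \<open>\<lambda> = 0\<close>, where \<open>Lambda\<close> has a vertical tangent, a limit of supporting lines takes over.
  Concavity (lemma \<open>Lambda_supporting_line\<close>) comes from the representation of
  \<open>1 / Lambda x\<close> as the integral of \<open>(1 - t) / (1 + t (x - 1))\<close> over the unit interval.
  The measure-theoretic conclusion is \<open>weighted_Lr_entropy_bound\<close>, valid on every measure space.

  For the quantum entropy, \<open>Phi \<epsilon> x\<close> is \<open>x ln x + (1 - \<epsilon> x) ln (1 - \<epsilon> x) / \<epsilon>\<close>.  Its Bregman
  divergence is the one of \<open>x ln x\<close> plus a second, nonnegative one in the variable
  \<open>1 - \<epsilon> x\<close>, so it dominates \<open>f ln (f/M) - f + M\<close>.
  The integral of this Bregman divergence is the relative entropy, because the linear
  term \<open>ln (phi \<epsilon> M)\<close> is a quadratic polynomial in the velocity and \<open>f\<close> and \<open>M\<close> have the same moments.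

  All this presupposes that the equilibrium, given by a definite description, is what it should be.
  Uniqueness follows from the same quadratic polynomials and strict monotonicity.  For existence,
  translation and scaling leave one parameter \<open>a\<close>, which has to solve
  \<open>I\<^sub>2(a)\<^sup>3 = (27 T\<^sup>3 / \<rho>\<^sup>2) I\<^sub>0(a)\<^sup>5\<close> for the moments \<open>I\<^sub>k\<close> of the standard profile.
  The intermediate value theorem applies: the quotient \<open>I\<^sub>2\<^sup>3 / I\<^sub>0\<^sup>5\<close> is large in the dilute
  regime, and in the dense regime it approaches its value for the indicator function of a ball
  (divided by \<open>\<epsilon>\<close>), which is exactly the threshold \<open>\<gamma> = 2/5\<close>.  For \<open>\<epsilon> = 0\<close> it tends to \<open>0\<close>, and
  every temperature is reached.
\<close>

section \<open>Concavity of the function \<open>Lambda\<close>\<close>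

text \<open>
  This is the form in which the Cauchy-Schwarz inequality is used twice below: the optimal
  \<open>s = a / D\<close> turns a family of linear bounds into a bound on the square of \<open>a\<close>.
\<close>

lemma square_le_of_quadratic_le:
  fixes a D H :: real
  assumes quad: "\<And>s. 2 * s * a - s\<^sup>2 * D \<le> H" and "0 \<le> D"
  shows "a\<^sup>2 \<le> H * D"
proof (cases "D = 0")
  case True
  have "a = 0"
  proof (rule ccontr)
    assume "a \<noteq> 0"
    with quad[of "(H + 1) / (2 * a)"] True show False by simp
  qed
  with True show ?thesis by simp
next
  case False
  have "2 * (a / D) * a - (a / D)\<^sup>2 * D = a\<^sup>2 / D"
    using False by (simp add: power2_eq_square)
  with quad[of "a / D"] have "a\<^sup>2 / D \<le> H" by simp
  with False \<open>0 \<le> D\<close> show ?thesis by (simp add: pos_divide_le_eq)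
qed

lemma xlnx_bregman_nonneg:
  fixes x :: real
  assumes "0 \<le> x"
  shows "0 \<le> x * ln x - x + 1"
proof (cases "x = 0")
  case False
  with assms have "ln (1 / x) \<le> 1 / x - 1" by (intro ln_le_minus_one) auto
  with assms False have "x * (- ln x) \<le> x * (1 / x - 1)"
    by (intro mult_left_mono) (auto simp: ln_div)
  with False show ?thesis by (simp add: algebra_simps)
qed simp

lemma xlnx_bregman_pos:
  fixes x :: real
  assumes "0 \<le> x" "x \<noteq> 1"
  shows "0 < x * ln x - x + 1"
proof (cases "x = 0")
  case False
  with assms have "ln (1 / x) \<noteq> 1 / x - 1" using ln_eq_minus_one[of "1 / x"] by auto
  moreover have "ln (1 / x) \<le> 1 / x - 1" using False assms by (intro ln_le_minus_one) auto
  ultimately have "ln (1 / x) < 1 / x - 1" by simp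
  with assms False have "x * (- ln x) < x * (1 / x - 1)"
    by (intro mult_strict_left_mono) (auto simp: ln_div)
  with False show ?thesis by (simp add: algebra_simps)
qed simp

lemma Lambda_pos:
  assumes "0 \<le> x"
  shows "0 < Lambda x"
  using xlnx_bregman_pos[OF assms] by (auto simp: Lambda_def)

text \<open>
  This is Taylor's formula for \<open>x ln x - x + 1\<close> at \<open>1\<close> with integral remainder, divided by
  \<open>(x - 1)\<^sup>2\<close>.
\<close>

lemma Lambda_reciprocal_integral:
  assumes x: "0 \<le> x"
  shows "((\<lambda>t. (1 - t) / (1 + t * (x - 1))) has_integral 1 / Lambda x) {0..1}"
proof -
  consider "x = 0" | "x = 1" | "x > 0" "x \<noteq> 1" using x by linarith
  then show ?thesis
  proof cases
    case 1
    have "((\<lambda>t::real. 1::real) has_integral 1) {0..1}"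
      using has_integral_const_real[of "1::real" 0 1] by simp
    then have "((\<lambda>t::real. (1 - t) / (1 - t)) has_integral 1) {0..1}"
      by (rule has_integral_spike_finite[of "{1}", rotated 2]) auto
    with 1 show ?thesis by (simp add: Lambda_def)
  next
    case 2
    have "((\<lambda>t::real. 1 - t) has_integral (1 - 1\<^sup>2 / 2) - (0 - 0\<^sup>2 / 2)) {0..1}"
      by (rule fundamental_theorem_of_calculus)
         (auto intro!: derivative_eq_intros simp: has_real_derivative_iff_has_vector_derivative[symmetric])
    with 2 show ?thesis by (simp add: Lambda_def)
  next
    case 3
    define d where "d = x - 1"
    have d: "d \<noteq> 0" "d > -1" using 3 by (auto simp: d_def)
    have pos: "1 + t * d > 0" if "0 \<le> t" "t \<le> 1" for t
    proof -
      have "1 + t * d = (1 - t) + t * x" by (simp add: d_def algebra_simps)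
      moreover have "0 \<le> t * x" using that 3 by simp
      moreover have "t = 1 \<Longrightarrow> 0 < t * x" using 3 by simp
      ultimately show ?thesis using that by linarith
    qed
    define c where "c = (d + 1) / d\<^sup>2"
    define F where "F t = - t / d + c * ln (1 + t * d)" for t
    have "((\<lambda>t. (1 - t) / (1 + t * d)) has_integral F 1 - F 0) {0..1}"
    proof (rule fundamental_theorem_of_calculus)
      fix t :: real assume t: "t \<in> {0..1}"
      note p = pos[of t]
      have "(F has_real_derivative - 1 / d + c * (d / (1 + t * d))) (at t within {0..1})"
        unfolding F_def using p t d
          by (auto intro!: derivative_eq_intros)
      also have "- 1 / d + c * (d / (1 + t * d)) = (1 - t) / (1 + t * d)"
        using p t d by (simp add: c_def divide_simps power2_eq_square) (simp add: algebra_simps)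
      finally show "(F has_vector_derivative (1 - t) / (1 + t * d)) (at t within {0..1})"
        by (simp add: has_real_derivative_iff_has_vector_derivative)
    qed simp
    also have "F 1 - F 0 = (x * ln x - x + 1) / (x - 1)\<^sup>2"
    proof -
      have x_eq: "x = d + 1" by (simp add: d_def)
      show ?thesis unfolding x_eq using d
        by (simp add: F_def c_def divide_simps power2_eq_square)
    qed
    finally show ?thesis using 3 by (simp add: Lambda_def d_def)
  qed
qed

text \<open>
  Write \<open>m\<^sub>t(x) = 1 + t (x - 1)\<close> and \<open>\<kappa> = 1 / Lambda l\<close>.  For every real \<open>c\<close>, \<open>1 / m\<^sub>t(x)\<close> is at
  least \<open>2 c - c\<^sup>2 m\<^sub>t(x)\<close>.  With \<open>c = s / m\<^sub>t(l)\<close>, integration against \<open>1 - t\<close> gives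
  \<open>1 / Lambda x \<ge> 2 s \<kappa> - s\<^sup>2 (p + q x)\<close>, where \<open>p + q l = \<kappa>\<close>.
  Optimising \<open>s\<close> gives \<open>Lambda x \<le> (p + q x) / \<kappa>\<^sup>2\<close>, with equality at \<open>x = l\<close>.
  In the last conclusion the quotient is cleared, so that \<open>x = 1\<close> needs no special treatment later.
  The point \<open>l = 0\<close> is excluded because the tangent of \<open>Lambda\<close> is vertical there.
\<close>

lemma Lambda_supporting_line:
  assumes l: "0 < l"
  obtains \<alpha> \<beta> where "0 < \<alpha>" "0 \<le> \<beta>" "\<alpha> + \<beta> * l = Lambda l"
    "\<And>x. 0 \<le> x \<Longrightarrow> (x - 1)\<^sup>2 \<le> (x * ln x - x + 1) * (\<alpha> + \<beta> * x)"
proof -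
  define m where "m t x = 1 + t * (x - 1)" for t x :: real
  have m_alt: "m t x = (1 - t) + t * x" for t x by (simp add: m_def algebra_simps)
  have ml: "m t l > 0" if "0 \<le> t" "t \<le> 1" for t
    unfolding m_alt using that l by (cases "t = 1") (auto intro!: add_pos_nonneg)
  define \<kappa> where "\<kappa> = 1 / Lambda l"
  have \<kappa>: "\<kappa> > 0" using Lambda_pos[of l] l by (simp add: \<kappa>_def)
  define p where "p = integral {0..1} (\<lambda>t. (1 - t)\<^sup>2 / (m t l)\<^sup>2)"
  define q where "q = integral {0..1} (\<lambda>t. t * (1 - t) / (m t l)\<^sup>2)"
  have cont: "continuous_on {0..1} (\<lambda>t. m t l)" unfolding m_def by (intro continuous_intros)
  have P: "((\<lambda>t. (1 - t)\<^sup>2 / (m t l)\<^sup>2) has_integral p) {0..1}" unfolding p_def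
    by (intro integrable_integral integrable_continuous_real continuous_intros cont)
       (use ml in fastforce)
  have Q: "((\<lambda>t. t * (1 - t) / (m t l)\<^sup>2) has_integral q) {0..1}" unfolding q_def
    by (intro integrable_integral integrable_continuous_real continuous_intros cont)
       (use ml in fastforce)
  have K: "((\<lambda>t. (1 - t) / m t x) has_integral 1 / Lambda x) {0..1}" if "0 \<le> x" for x
    using Lambda_reciprocal_integral[OF that] by (simp add: m_def)
  have p0: "p \<ge> 0" by (rule has_integral_nonneg[OF P]) auto
  have q0: "q \<ge> 0" by (rule has_integral_nonneg[OF Q]) auto
  have pq: "p + q * l = \<kappa>"
  proof -
    have "((\<lambda>t. (1 - t)\<^sup>2 / (m t l)\<^sup>2 + t * (1 - t) / (m t l)\<^sup>2 * l) has_integral p + q * l) {0..1}"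
      by (intro has_integral_add P has_integral_mult_left Q)
    then have "((\<lambda>t. (1 - t) / m t l) has_integral p + q * l) {0..1}"
    proof (rule has_integral_eq[rotated])
      fix t :: real assume t: "t \<in> {0..1}"
      have "(1 - t)\<^sup>2 / (m t l)\<^sup>2 + t * (1 - t) / (m t l)\<^sup>2 * l = (1 - t) * ((1 - t) + t * l) / (m t l)\<^sup>2"
        by (simp add: add_divide_distrib algebra_simps power2_eq_square diff_divide_distrib)
      also have "\<dots> = (1 - t) / m t l" using ml[of t] t
        by (simp add: m_alt[symmetric] power2_eq_square)
      finally show "(1 - t)\<^sup>2 / (m t l)\<^sup>2 + t * (1 - t) / (m t l)\<^sup>2 * l = (1 - t) / m t l" .
    qed
    with K[of l] l show ?thesis unfolding \<kappa>_def by (metis has_integral_unique less_imp_le)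
  qed
  have tangent: "2 * s * \<kappa> - s\<^sup>2 * (p + q * x) \<le> 1 / Lambda x" if x: "0 \<le> x" for s x
  proof (rule has_integral_le[OF _ K[OF x]])
    show "((\<lambda>t. 2 * s * ((1 - t) / m t l) - s\<^sup>2 * ((1 - t)\<^sup>2 / (m t l)\<^sup>2 + t * (1 - t) / (m t l)\<^sup>2 * x))
       has_integral 2 * s * \<kappa> - s\<^sup>2 * (p + q * x)) {0..1}"
      using K[of l] l unfolding \<kappa>_def
      by (intro has_integral_diff has_integral_mult_right has_integral_add P Q has_integral_mult_left) auto
    fix t :: real assume t: "t \<in> {0..1}"
    show "2 * s * ((1 - t) / m t l) - s\<^sup>2 * ((1 - t)\<^sup>2 / (m t l)\<^sup>2 + t * (1 - t) / (m t l)\<^sup>2 * x) \<le> (1 - t) / m t x"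
    proof (cases "t = 1")
      case False
      define c where "c = s / m t l"
      have mx: "m t x > 0" unfolding m_alt using False t x by (intro add_pos_nonneg) auto
      have "2 * s * ((1 - t) / m t l) - s\<^sup>2 * ((1 - t)\<^sup>2 / (m t l)\<^sup>2 + t * (1 - t) / (m t l)\<^sup>2 * x)
          = (1 - t) * (2 * c - c\<^sup>2 * m t x)"
        unfolding c_def m_alt[of t x] by (simp add: power2_eq_square algebra_simps add_divide_distrib diff_divide_distrib)
      also have "\<dots> \<le> (1 - t) * (1 / m t x)"
      proof (rule mult_left_mono)
        have "0 \<le> (c * m t x - 1)\<^sup>2" by simp
        then have "(2 * c - c\<^sup>2 * m t x) * m t x \<le> 1" by (simp add: power2_eq_square algebra_simps)
        then show "2 * c - c\<^sup>2 * m t x \<le> 1 / m t x" using mx by (simp add: pos_le_divide_eq)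
      qed (use t in auto)
      finally show ?thesis by simp
    qed simp
  qed
  have main: "\<kappa>\<^sup>2 \<le> 1 / Lambda x * (p + q * x)" if x: "0 \<le> x" for x
    using p0 q0 x by (intro square_le_of_quadratic_le tangent) auto
  have line: "(x - 1)\<^sup>2 \<le> (x * ln x - x + 1) * (p / \<kappa>\<^sup>2 + q / \<kappa>\<^sup>2 * x)" if x: "0 \<le> x" for x
  proof (cases "x = 1")
    case False
    then have h: "x * ln x - x + 1 > 0" using xlnx_bregman_pos x by simp
    have "1 \<le> 1 / Lambda x * (p / \<kappa>\<^sup>2 + q / \<kappa>\<^sup>2 * x)"
    proof -
      have "1 \<le> (1 / Lambda x * (p + q * x)) / \<kappa>\<^sup>2"
        using main[OF x] \<kappa> by (subst pos_le_divide_eq) auto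
      then show ?thesis by (simp add: add_divide_distrib distrib_left)
    qed
    also have "1 / Lambda x = (x * ln x - x + 1) / (x - 1)\<^sup>2" using False by (simp add: Lambda_def)
    finally show ?thesis using False by (simp add: field_simps)
  qed simp
  show ?thesis
  proof (rule that[of "p / \<kappa>\<^sup>2" "q / \<kappa>\<^sup>2"])
    \<comment> \<open>at \<open>x = 0\<close> the line lies above \<open>Lambda 0 = 1\<close>\<close>
    show "p / \<kappa>\<^sup>2 > 0" using line[of 0] by simp
    show "p / \<kappa>\<^sup>2 + q / \<kappa>\<^sup>2 * l = Lambda l"
    proof -
      have "p / \<kappa>\<^sup>2 + q / \<kappa>\<^sup>2 * l = (p + q * l) / \<kappa>\<^sup>2" by (simp add: add_divide_distrib)
      also have "\<dots> = Lambda l" unfolding pq by (simp add: \<kappa>_def power2_eq_square)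
      finally show ?thesis .
    qed
  qed (use q0 line in auto)
qed

lemma Lambda_tendsto_at_zero: "(Lambda \<longlongrightarrow> 1) (at_right 0)"
proof -
  have "((\<lambda>x::real. (x - 1)\<^sup>2 / (x * ln x - x + 1)) \<longlongrightarrow> 1) (at_right 0)" by real_asymp
  moreover have "\<forall>\<^sub>F x in at_right (0::real). (x - 1)\<^sup>2 / (x * ln x - x + 1) = Lambda x"
    using eventually_at_right_real[OF zero_less_one] by eventually_elim (auto simp: Lambda_def)
  ultimately show ?thesis by (rule Lim_transform_eventually)
qed

text \<open>
  The supporting line, made homogeneous, bounds \<open>(x - y)\<^sup>2 / (\<alpha> y + \<beta> x)\<close> by the Bregman divergence of
  \<open>x ln x\<close>.  Here the square is linearised with free parameters \<open>s\<close> and \<open>w\<close>: the right-hand side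
  then splits into terms that can be integrated one by one.
\<close>

lemma Bregman_xlnx_lower_bound:
  fixes x y :: real
  assumes "0 < \<alpha>" "0 \<le> \<beta>" and x: "0 \<le> x" and y: "0 < y"
    and line: "\<And>x. 0 \<le> x \<Longrightarrow> (x - 1)\<^sup>2 \<le> (x * ln x - x + 1) * (\<alpha> + \<beta> * x)"
  shows "2 * s * (\<bar>x - y\<bar> * w) - s\<^sup>2 * (\<alpha> * (y * w\<^sup>2) + \<beta> * (x * w\<^sup>2)) \<le> x * ln (x / y) - x + y"
proof -
  define z where "z = x / y"
  define D where "D = \<alpha> + \<beta> * z"
  define h where "h = z * ln z - z + 1"
  have z: "z \<ge> 0" "x = z * y" using x y by (auto simp: z_def)
  have D: "D > 0" unfolding D_def using assms z by (intro add_pos_nonneg) auto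
  have "0 \<le> (\<bar>z - 1\<bar> - s * w * D)\<^sup>2" by simp
  then have "(2 * s * (\<bar>z - 1\<bar> * w) - s\<^sup>2 * w\<^sup>2 * D) * D \<le> (z - 1)\<^sup>2"
    by (simp add: power2_eq_square algebra_simps)
  also have "\<dots> \<le> h * D" using line[OF z(1)] by (simp add: h_def D_def)
  finally have "2 * s * (\<bar>z - 1\<bar> * w) - s\<^sup>2 * w\<^sup>2 * D \<le> h" using D by simp
  then have "y * (2 * s * (\<bar>z - 1\<bar> * w) - s\<^sup>2 * w\<^sup>2 * D) \<le> y * h" using y by simp
  moreover have "\<bar>x - y\<bar> = y * \<bar>z - 1\<bar>" using y z
    by (metis abs_mult abs_of_pos mult.commute mult.right_neutral right_diff_distrib')
  moreover have "y * h = x * ln (x / y) - x + y" using y z by (simp add: h_def algebra_simps)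
  ultimately show ?thesis using z by (simp add: D_def algebra_simps)
qed

section \<open>A weighted Pinsker inequality in \<open>L\<^sup>r\<close>\<close>

lemma Lp_norm_nonneg: "0 \<le> Lp_norm p M g"
  by (simp add: Lp_norm_def)

lemma Lp_norm_powr:
  assumes "0 < p"
  shows "(\<integral>x. \<bar>g x\<bar> powr p \<partial>M) = Lp_norm (ennreal p) M g powr p"
  using assms by (simp add: Lp_norm_def powr_powr)

lemma Lp_space_integrable:
  assumes "0 < p" "g \<in> Lp_space (ennreal p) M"
  shows "integrable M (\<lambda>x. \<bar>g x\<bar> powr p)"
  using assms by (simp add: Lp_space_def)

lemma Lp_norm_infinity_AE:
  assumes "g \<in> Lp_space \<infinity> M"
  shows "AE x in M. \<bar>g x\<bar> \<le> Lp_norm \<infinity> M g"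
proof -
  have fin: "esssup M (\<lambda>x. ennreal \<bar>g x\<bar>) < \<infinity>" using assms by (simp add: Lp_space_def)
  have "AE x in M. ennreal \<bar>g x\<bar> \<le> esssup M (\<lambda>x. ennreal \<bar>g x\<bar>)" by (rule esssup_AE)
  then show ?thesis
  proof eventually_elim
    case (elim x)
    then have "enn2real (ennreal \<bar>g x\<bar>) \<le> enn2real (esssup M (\<lambda>x. ennreal \<bar>g x\<bar>))"
      using fin by (intro enn2real_mono) auto
    then show ?case by (simp add: Lp_norm_def)
  qed
qed

lemma Lp_norm_eq_0_AE:
  assumes "p = \<infinity> \<or> (\<exists>q>0. p = ennreal q)" and g: "g \<in> Lp_space p M" and 0: "Lp_norm p M g = 0"
  shows "AE x in M. g x = 0"
  using assms(1)
proof
  assume "p = \<infinity>"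
  with Lp_norm_infinity_AE[of g M] g 0 show ?thesis by auto
next
  assume "\<exists>q>0. p = ennreal q"
  then obtain q where q: "q > 0" "p = ennreal q" by auto
  have "(\<integral>x. \<bar>g x\<bar> powr q \<partial>M) = 0" using Lp_norm_powr[OF q(1), of M g] 0 q by simp
  then have "AE x in M. \<bar>g x\<bar> powr q = 0"
    using Lp_space_integrable[OF q(1)] g q by (subst (asm) integral_nonneg_eq_0_iff_AE) auto
  then show ?thesis by simp
qed

lemma weight_exponent_cases:
  assumes "1 \<le> r" "r \<le> 2"
  shows "weight_exponent r = \<infinity> \<or> (\<exists>q>0. weight_exponent r = ennreal q)"
  using assms by (auto simp: weight_exponent_def intro!: exI[of _ "r / (2 - r)"])

text \<open>
  For \<open>1 < r < 2\<close> the exponent conjugate to \<open>p = r / (2 - r)\<close> is \<open>r / (2 (r - 1))\<close>, and \<open>g\<^sup>2\<close> raised to it is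
  \<open>\<bar>d\<bar>\<^sup>r / N\<^sup>r\<close>, which has integral \<open>1\<close>.  So this is Hoelder's inequality for \<open>h\<close> and \<open>g\<^sup>2\<close>, where \<open>g\<close>
  is the function that realises the \<open>L\<^sup>r\<close> norm of \<open>d\<close> by duality.  For \<open>r < 2\<close> the pointwise
  inequality of Young is integrated (at \<open>r = 1\<close> it says that \<open>g\<^sup>2 \<le> 1\<close>); for \<open>r = 2\<close> the function \<open>h\<close> is essentially bounded.
\<close>

lemma dual_weight_pairing:
  fixes M :: "'a measure" and d h :: "'a \<Rightarrow> real" and r :: real
  defines "N \<equiv> Lp_norm (ennreal r) M d" and "p \<equiv> weight_exponent r"
  defines "g \<equiv> \<lambda>x. (\<bar>d x\<bar> / N) powr (r - 1)"
  assumes r: "1 \<le> r" "r \<le> 2"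
    and d: "d \<in> Lp_space (ennreal r) M" and N: "0 < N"
    and h: "h \<in> Lp_space p M" and h0: "AE x in M. 0 \<le> h x"
  shows "integrable M (\<lambda>x. h x * (g x)\<^sup>2)" and "(\<integral>x. h x * (g x)\<^sup>2 \<partial>M) \<le> Lp_norm p M h"
proof -
  define b where "b x = (\<bar>d x\<bar> / N) powr r" for x
  have [measurable]: "d \<in> borel_measurable M" "h \<in> borel_measurable M"
    using d h by (auto simp: Lp_space_def)
  have b_alt: "b x = \<bar>d x\<bar> powr r / N powr r" for x using N by (simp add: b_def powr_divide)
  have b_int: "integrable M b"
    using Lp_space_integrable[OF _ d] r unfolding b_alt by auto
  have b_1: "(\<integral>x. b x \<partial>M) = 1"
    using Lp_norm_powr[of r M d] r N unfolding b_alt by (simp add: N_def)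
  have g2: "(g x)\<^sup>2 = (\<bar>d x\<bar> / N) powr (2 * (r - 1))" for x
    unfolding g_def by (simp add: power2_eq_square powr_add[symmetric])
  have "\<exists>G. integrable M G \<and> (\<integral>x. G x \<partial>M) \<le> Lp_norm p M h \<and> (AE x in M. h x * (g x)\<^sup>2 \<le> G x)"
  proof (cases "r = 2")
    case True
    then have p: "p = \<infinity>" by (simp add: p_def weight_exponent_def)
    show ?thesis
    proof (intro exI conjI)
      show "integrable M (\<lambda>x. Lp_norm p M h * b x)" using b_int by simp
      show "(\<integral>x. Lp_norm p M h * b x \<partial>M) \<le> Lp_norm p M h" using b_1 by simp
      show "AE x in M. h x * (g x)\<^sup>2 \<le> Lp_norm p M h * b x"
        unfolding p using Lp_norm_infinity_AE[OF h[unfolded p]]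
      proof eventually_elim
        case (elim x)
        then show ?case using True by (simp add: g2 b_def mult_right_mono)
      qed
    qed
  next
    case False
    define q where "q = r / (2 - r)"
    have q: "q > 0" "p = ennreal q" using False r by (auto simp: q_def p_def weight_exponent_def)
    define A where "A = Lp_norm p M h"
    define \<alpha> \<beta> where "\<alpha> = (2 - r) / r" and "\<beta> = 2 * (r - 1) / r"
    have ab: "0 \<le> \<alpha>" "0 \<le> \<beta>" "\<alpha> + \<beta> = 1" using r by (auto simp: \<alpha>_def \<beta>_def field_simps)
    show ?thesis
    proof (cases "A = 0")
      case True
      then have "AE x in M. h x = 0" using q h by (intro Lp_norm_eq_0_AE[of p]) (auto simp: A_def)
      then show ?thesis using True by (intro exI[of _ "\<lambda>_. 0"]) (auto simp: A_def)
    next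
      case False
      then have A: "A > 0" using Lp_norm_nonneg[of p M h] by (simp add: A_def)
      define k where "k x = (\<bar>h x\<bar> / A) powr q" for x
      have k_alt: "k x = \<bar>h x\<bar> powr q / A powr q" for x using A by (simp add: k_def powr_divide)
      have k_int: "integrable M k"
        using Lp_space_integrable[OF q(1) h[unfolded q(2)]] unfolding k_alt by simp
      have k_1: "(\<integral>x. k x \<partial>M) = 1"
        using Lp_norm_powr[OF q(1), of M h] A q unfolding k_alt by (simp add: A_def)
      show ?thesis
      proof (intro exI conjI)
        show "integrable M (\<lambda>x. A * (\<alpha> * k x + \<beta> * b x))" using b_int k_int by simp
        have "(\<integral>x. A * (\<alpha> * k x + \<beta> * b x) \<partial>M) = A * (\<alpha> * 1 + \<beta> * 1)"
          using b_int k_int b_1 k_1 by simp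
        also have "\<dots> = A" using ab by simp
        finally show "(\<integral>x. A * (\<alpha> * k x + \<beta> * b x) \<partial>M) \<le> Lp_norm p M h" using A_def by linarith
        show "AE x in M. h x * (g x)\<^sup>2 \<le> A * (\<alpha> * k x + \<beta> * b x)"
          using h0
        proof eventually_elim
          case (elim x)
          show ?case
          proof (cases "h x = 0 \<or> d x = 0")
            case True
            then have "h x * (g x)\<^sup>2 = 0" by (auto simp: g_def)
            also have "0 \<le> A * (\<alpha> * k x + \<beta> * b x)"
              using A ab by (auto simp: k_def b_def intro!: mult_nonneg_nonneg add_nonneg_nonneg)
            finally show ?thesis .
          next
            case False
            have "k x powr \<alpha> = h x / A"
              using r \<open>r \<noteq> 2\<close> A elim by (simp add: k_def powr_powr q_def \<alpha>_def)
            moreover have "b x powr \<beta> = (g x)\<^sup>2"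
              unfolding g2 using r by (simp add: b_def powr_powr \<beta>_def)
            moreover have "k x powr \<alpha> * b x powr \<beta> \<le> \<alpha> * k x + \<beta> * b x"
              using False A N by (intro Youngs_inequality_0 ab) (auto simp: k_def b_def)
            ultimately have "h x / A * (g x)\<^sup>2 \<le> \<alpha> * k x + \<beta> * b x" by simp
            then show ?thesis using A by (simp add: pos_divide_le_eq mult.commute)
          qed
        qed
      qed
    qed
  qed
  then obtain G where G: "integrable M G" "(\<integral>x. G x \<partial>M) \<le> Lp_norm p M h"
    "AE x in M. h x * (g x)\<^sup>2 \<le> G x" by blast
  have gm: "g \<in> borel_measurable M" unfolding g_def by measurable
  show int: "integrable M (\<lambda>x. h x * (g x)\<^sup>2)"
  proof (rule Bochner_Integration.integrable_bound[OF G(1)])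
    show "AE x in M. norm (h x * (g x)\<^sup>2) \<le> norm (G x)"
      using G(3) h0 by eventually_elim auto
  qed (use gm in measurable)
  have "(\<integral>x. h x * (g x)\<^sup>2 \<partial>M) \<le> (\<integral>x. G x \<partial>M)" by (intro integral_mono_AE int G)
  with G(2) show "(\<integral>x. h x * (g x)\<^sup>2 \<partial>M) \<le> Lp_norm p M h" by simp
qed

text \<open>
  The norm \<open>N\<close> of \<open>(f - m) \<omega>\<close> is the integral of \<open>\<bar>f - m\<bar> \<omega> g\<close> with the dual function \<open>g\<close>.
  The pointwise bound with \<open>w = \<omega> g\<close> and the pairing lemma give
  \<open>2 s N - s\<^sup>2 (\<alpha> A + \<beta> B) \<le> H\<close> for all \<open>s\<close>, where \<open>H\<close> is the entropy integral.  Hence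
  \<open>N\<^sup>2 \<le> H (\<alpha> A + \<beta> B)\<close>, and the line that supports \<open>Lambda\<close> at \<open>B / A\<close> makes the right-hand side
  equal to \<open>A \<Lambda>(B/A) H\<close>.
\<close>

lemma weighted_Lr_entropy_bound:
  fixes M :: "'a measure" and f m \<omega> :: "'a \<Rightarrow> real" and r :: real
  defines "A \<equiv> Lp_norm (weight_exponent r) M (\<lambda>x. m x * (\<omega> x)\<^sup>2)"
    and "B \<equiv> Lp_norm (weight_exponent r) M (\<lambda>x. f x * (\<omega> x)\<^sup>2)"
  assumes r: "1 \<le> r" "r \<le> 2"
    and f0: "AE x in M. 0 \<le> f x" and m0: "AE x in M. 0 < m x" and w0: "\<And>x. 0 \<le> \<omega> x"
    and d: "(\<lambda>x. (f x - m x) * \<omega> x) \<in> Lp_space (ennreal r) M"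
    and mw: "(\<lambda>x. m x * (\<omega> x)\<^sup>2) \<in> Lp_space (weight_exponent r) M"
    and fw: "(\<lambda>x. f x * (\<omega> x)\<^sup>2) \<in> Lp_space (weight_exponent r) M"
    and F: "integrable M (\<lambda>x. f x * ln (f x / m x) - f x + m x)"
  shows "(Lp_norm (ennreal r) M (\<lambda>x. (f x - m x) * \<omega> x))\<^sup>2
    \<le> A * Lambda (B / A) * (\<integral>x. f x * ln (f x / m x) - f x + m x \<partial>M)"
proof -
  define N where "N = Lp_norm (ennreal r) M (\<lambda>x. (f x - m x) * \<omega> x)"
  define H where "H = (\<integral>x. f x * ln (f x / m x) - f x + m x \<partial>M)"
  have AB: "A \<ge> 0" "B \<ge> 0" by (auto simp: A_def B_def Lp_norm_nonneg)
  have N0: "N \<ge> 0" by (simp add: N_def Lp_norm_nonneg)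
  \<comment> \<open>any supporting line shows that the entropy integrand is nonnegative; the one at \<open>1\<close> will do\<close>
  obtain \<alpha>1 \<beta>1 :: real where ab1: "0 < \<alpha>1" "0 \<le> \<beta>1"
    "\<And>x. 0 \<le> x \<Longrightarrow> (x - 1)\<^sup>2 \<le> (x * ln x - x + 1) * (\<alpha>1 + \<beta>1 * x)"
    using Lambda_supporting_line[OF zero_less_one] by metis
  have H0: "H \<ge> 0" unfolding H_def
  proof (rule integral_nonneg_AE)
    show "AE x in M. 0 \<le> f x * ln (f x / m x) - f x + m x"
      using f0 m0
    proof eventually_elim
      case (elim x)
      with Bregman_xlnx_lower_bound[OF ab1(1,2) _ _ ab1(3), of "f x" "m x" 0] show ?case by simp
    qed
  qed
  have key: "N\<^sup>2 \<le> H * (\<alpha> * A + \<beta> * B)" if "N > 0" and ab: "0 < \<alpha>" "0 \<le> \<beta>"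
    and line: "\<And>x. 0 \<le> x \<Longrightarrow> (x - 1)\<^sup>2 \<le> (x * ln x - x + 1) * (\<alpha> + \<beta> * x)" for \<alpha> \<beta>
  proof (rule square_le_of_quadratic_le)
    show "0 \<le> \<alpha> * A + \<beta> * B" using ab AB by simp
    fix s :: real
    define g where "g x = (\<bar>(f x - m x) * \<omega> x\<bar> / N) powr (r - 1)" for x
    have mi: "integrable M (\<lambda>x. m x * (\<omega> x)\<^sup>2 * (g x)\<^sup>2)" "(\<integral>x. m x * (\<omega> x)\<^sup>2 * (g x)\<^sup>2 \<partial>M) \<le> A"
      unfolding g_def A_def N_def using \<open>N > 0\<close> m0 unfolding N_def
      by (intro dual_weight_pairing[OF r d _ mw]; force)+
    have fi: "integrable M (\<lambda>x. f x * (\<omega> x)\<^sup>2 * (g x)\<^sup>2)" "(\<integral>x. f x * (\<omega> x)\<^sup>2 * (g x)\<^sup>2 \<partial>M) \<le> B"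
      unfolding g_def B_def N_def using \<open>N > 0\<close> f0 unfolding N_def
      by (intro dual_weight_pairing[OF r d _ fw]; force)+
    have di: "\<bar>f x - m x\<bar> * (\<omega> x * g x) = \<bar>(f x - m x) * \<omega> x\<bar> powr r / N powr (r - 1)" for x
    \<comment> \<open>separate because \<open>0 powr 0 = 0\<close> makes \<open>g\<close> vanish here, also for \<open>r = 1\<close>\<close>
    proof (cases "(f x - m x) * \<omega> x = 0")
      case False
      have "\<bar>f x - m x\<bar> * (\<omega> x * g x)
          = \<bar>(f x - m x) * \<omega> x\<bar> powr 1 * \<bar>(f x - m x) * \<omega> x\<bar> powr (r - 1) / N powr (r - 1)"
        using False N0 w0 by (simp add: g_def powr_divide abs_mult)
      then show ?thesis unfolding powr_add[symmetric] by simp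
    qed (use w0[of x] in \<open>auto simp: g_def\<close>)
    have dint: "integrable M (\<lambda>x. \<bar>f x - m x\<bar> * (\<omega> x * g x))"
      unfolding di using Lp_space_integrable[OF _ d] r by simp
    have dN: "(\<integral>x. \<bar>f x - m x\<bar> * (\<omega> x * g x) \<partial>M) = N"
    proof -
      have "(\<integral>x. \<bar>f x - m x\<bar> * (\<omega> x * g x) \<partial>M) = N powr r / N powr (r - 1)"
        unfolding di N_def using Lp_norm_powr[of r M "\<lambda>x. (f x - m x) * \<omega> x"] r by simp
      also have "\<dots> = N" using \<open>N > 0\<close> by (simp add: powr_diff)
      finally show ?thesis .
    qed
    have "2 * s * N - s\<^sup>2 * (\<alpha> * A + \<beta> * B)
      \<le> 2 * s * N - s\<^sup>2 * (\<alpha> * (\<integral>x. m x * (\<omega> x)\<^sup>2 * (g x)\<^sup>2 \<partial>M) + \<beta> * (\<integral>x. f x * (\<omega> x)\<^sup>2 * (g x)\<^sup>2 \<partial>M))"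
      using ab mi(2) fi(2) by (intro diff_left_mono mult_left_mono add_mono) auto
    also have "\<dots> = (\<integral>x. 2 * s * (\<bar>f x - m x\<bar> * (\<omega> x * g x))
        - s\<^sup>2 * (\<alpha> * (m x * (\<omega> x)\<^sup>2 * (g x)\<^sup>2) + \<beta> * (f x * (\<omega> x)\<^sup>2 * (g x)\<^sup>2)) \<partial>M)"
      using dint mi(1) fi(1) by (simp add: dN)
    also have "\<dots> \<le> H" unfolding H_def
    proof (rule integral_mono_AE)
      show "AE x in M. 2 * s * (\<bar>f x - m x\<bar> * (\<omega> x * g x))
        - s\<^sup>2 * (\<alpha> * (m x * (\<omega> x)\<^sup>2 * (g x)\<^sup>2) + \<beta> * (f x * (\<omega> x)\<^sup>2 * (g x)\<^sup>2))
        \<le> f x * ln (f x / m x) - f x + m x"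
        using f0 m0
      proof eventually_elim
        case (elim x)
        with Bregman_xlnx_lower_bound[OF ab _ _ line, of "f x" "m x" s "\<omega> x * g x"]
        show ?case by (simp add: power_mult_distrib mult.assoc)
      qed
    qed (use dint mi(1) fi(1) F in auto)
    finally show "2 * s * N - s\<^sup>2 * (\<alpha> * A + \<beta> * B) \<le> H" .
  qed
  have "N\<^sup>2 \<le> A * Lambda (B / A) * H"
  proof (cases "N = 0")
    case True
    have "0 \<le> Lambda (B / A)" using Lambda_pos[of "B / A"] AB by simp
    with True AB H0 show ?thesis by simp
  next
    case False
    then have N: "N > 0" using N0 by simp
    have "A \<noteq> 0"
    proof
      assume "A = 0"
      then have "AE x in M. m x * (\<omega> x)\<^sup>2 = 0"
        unfolding A_def by (rule Lp_norm_eq_0_AE[OF weight_exponent_cases[OF r] mw])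
      with m0 have "AE x in M. \<bar>(f x - m x) * \<omega> x\<bar> powr r = 0" by eventually_elim auto
      then have "(\<integral>x. \<bar>(f x - m x) * \<omega> x\<bar> powr r \<partial>M) = 0" by (rule integral_eq_zero_AE)
      then show False using N r by (simp add: N_def Lp_norm_def)
    qed
    then have A: "A > 0" using AB by simp
    show ?thesis
    proof (cases "B = 0")
      case False
      then have "B / A > 0" using AB A by simp
      from Lambda_supporting_line[OF this] obtain \<alpha> \<beta> where ab: "0 < \<alpha>" "0 \<le> \<beta>" "\<alpha> + \<beta> * (B / A) = Lambda (B / A)"
        "\<And>x. 0 \<le> x \<Longrightarrow> (x - 1)\<^sup>2 \<le> (x * ln x - x + 1) * (\<alpha> + \<beta> * x)" by metis
      have "\<alpha> * A + \<beta> * B = A * Lambda (B / A)" unfolding ab(3)[symmetric] using A by (simp add: field_simps)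
      with key[OF N ab(1,2,4)] show ?thesis by (simp add: mult.commute)
    next
      case True
      \<comment> \<open>no line supports \<open>Lambda\<close> at \<open>0\<close>, so the supporting point \<open>\<delta>\<close> tends to \<open>0\<close>\<close>
      have le: "N\<^sup>2 \<le> H * (Lambda \<delta> * A)" if \<delta>: "\<delta> > 0" for \<delta>
      proof -
        from Lambda_supporting_line[OF \<delta>] obtain \<alpha> \<beta> where ab: "0 < \<alpha>" "0 \<le> \<beta>" "\<alpha> + \<beta> * \<delta> = Lambda \<delta>"
          "\<And>x. 0 \<le> x \<Longrightarrow> (x - 1)\<^sup>2 \<le> (x * ln x - x + 1) * (\<alpha> + \<beta> * x)" by metis
        have "N\<^sup>2 \<le> H * (\<alpha> * A)" using key[OF N ab(1,2,4)] True by simp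
        also have "\<alpha> \<le> Lambda \<delta>" unfolding ab(3)[symmetric] using ab(2) \<delta> by simp
        then have "H * (\<alpha> * A) \<le> H * (Lambda \<delta> * A)" using H0 A by (intro mult_left_mono mult_right_mono) auto
        finally show ?thesis .
      qed
      have "((\<lambda>\<delta>. H * (Lambda \<delta> * A)) \<longlongrightarrow> H * (1 * A)) (at_right 0)"
        by (intro tendsto_intros Lambda_tendsto_at_zero)
      then have "N\<^sup>2 \<le> H * (1 * A)"
        by (rule tendsto_lowerbound) (auto intro!: eventually_at_rightI[of 0 1] le)
      with True show ?thesis by (simp add: Lambda_def mult.commute)
    qed
  qed
  then show ?thesis by (simp add: N_def H_def)
qed

section \<open>Entropy densities and their Bregman divergences\<close>

lemma continuous_on_xlnx: "continuous_on {0..} (\<lambda>x::real. x * ln x)"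
  unfolding continuous_on_def
proof
  fix x :: real assume "x \<in> {0..}"
  show "((\<lambda>x. x * ln x) \<longlongrightarrow> x * ln x) (at x within {0..})"
  proof (cases "x = 0")
    case True
    have "((\<lambda>x::real. x * ln x) \<longlongrightarrow> 0) (at_right 0)" by real_asymp
    with True show ?thesis by (simp add: at_within_Ici_at_right)
  next
    case False
    with \<open>x \<in> {0..}\<close> show ?thesis by (intro tendsto_intros) auto
  qed
qed

lemma Phi_zero_closed_form:
  assumes "0 \<le> x"
  shows "Phi 0 x = x * ln x - x"
proof -
  have "((\<lambda>y. ln (phi 0 y)) has_integral (x * ln x - x) - (0 * ln 0 - 0)) {0..x}"
  proof (rule fundamental_theorem_of_calculus_interior)
    show "continuous_on {0..x} (\<lambda>y. y * ln y - y)"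
      by (intro continuous_intros continuous_on_subset[OF continuous_on_xlnx]) auto
    fix y assume "y \<in> {0<..<x}"
    then have "((\<lambda>y. y * ln y - y) has_real_derivative ln (phi 0 y)) (at y)"
      by (auto intro!: derivative_eq_intros simp: phi_def)
    then show "((\<lambda>y. y * ln y - y) has_vector_derivative ln (phi 0 y)) (at y)"
      by (simp add: has_real_derivative_iff_has_vector_derivative)
  qed (rule assms)
  then show ?thesis unfolding Phi_def by (simp add: integral_unique)
qed

lemma Phi_closed_form:
  assumes e: "0 < \<epsilon>" and x: "0 \<le> x" "\<epsilon> * x \<le> 1"
  shows "Phi \<epsilon> x = x * ln x + (1 - \<epsilon> * x) * ln (1 - \<epsilon> * x) / \<epsilon>"
proof -
  define F where "F y = y * ln y + (1 - \<epsilon> * y) * ln (1 - \<epsilon> * y) / \<epsilon>" for y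
  have "((\<lambda>y. ln (phi \<epsilon> y)) has_integral F x - F 0) {0..x}"
  proof (rule fundamental_theorem_of_calculus_interior)
    have le: "\<epsilon> * y \<le> 1" if "y \<le> x" for y
      using that e x by (meson mult_left_mono less_imp_le order_trans)
    have "continuous_on {0..x} (\<lambda>y. (1 - \<epsilon> * y) * ln (1 - \<epsilon> * y))"
      by (rule continuous_on_compose2[OF continuous_on_xlnx]) (auto intro!: continuous_intros le)
    moreover have "continuous_on {0..x} (\<lambda>y. y * ln y)"
      by (rule continuous_on_subset[OF continuous_on_xlnx]) auto
    ultimately show "continuous_on {0..x} F" unfolding F_def
      using e by (intro continuous_on_add continuous_on_divide continuous_on_const) auto
    fix y assume y: "y \<in> {0<..<x}"
    then have "\<epsilon> * y < \<epsilon> * x" using e by auto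
    then have y1: "\<epsilon> * y < 1" using x by linarith
    have "(F has_real_derivative (ln y + 1) + (- \<epsilon> * ln (1 - \<epsilon> * y) - \<epsilon>) / \<epsilon>) (at y)"
      unfolding F_def using y y1 e by (auto intro!: derivative_eq_intros)
    also have "(ln y + 1) + (- \<epsilon> * ln (1 - \<epsilon> * y) - \<epsilon>) / \<epsilon> = ln (phi \<epsilon> y)"
      using y y1 e by (simp add: phi_def ln_div diff_divide_distrib)
    finally show "(F has_vector_derivative ln (phi \<epsilon> y)) (at y)"
      by (simp add: has_real_derivative_iff_has_vector_derivative)
  qed (rule x)
  then show ?thesis unfolding Phi_def by (simp add: integral_unique F_def)
qed

text \<open>
  The Bregman divergence of \<open>Phi \<epsilon>\<close> is a sum of two: that of \<open>x ln x\<close>, and \<open>1/\<epsilon>\<close> times that of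
  \<open>X ln X\<close> at \<open>X = 1 - \<epsilon> x\<close> and \<open>Y = 1 - \<epsilon> y\<close>.  The second one is nonnegative.
\<close>

lemma Bregman_Phi_ge_xlnx:
  assumes e: "0 \<le> \<epsilon>" and x: "0 \<le> x" "\<epsilon> * x \<le> 1" and y: "0 < y" "\<epsilon> * y < 1"
  shows "x * ln (x / y) - x + y \<le> Phi \<epsilon> x - Phi \<epsilon> y - ln (phi \<epsilon> y) * (x - y)"
proof -
  have lnxy: "x * ln (x / y) = x * ln x - x * ln y"
    using x y by (cases "x = 0") (auto simp: ln_div algebra_simps)
  show ?thesis
  proof (cases "\<epsilon> = 0")
    case True
    then show ?thesis using x y unfolding lnxy by (simp add: Phi_zero_closed_form phi_def algebra_simps)
  next
    case False
    with e have e: "\<epsilon> > 0" by simp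
    define X Y where "X = 1 - \<epsilon> * x" and "Y = 1 - \<epsilon> * y"
    have X: "X \<ge> 0" and Y: "Y > 0" using x y by (auto simp: X_def Y_def)
    have "0 \<le> Y * ((X / Y) * ln (X / Y) - X / Y + 1)"
      using X Y by (intro mult_nonneg_nonneg xlnx_bregman_nonneg) auto
    also have "\<dots> = X * ln (X / Y) - X + Y" using Y by (simp add: algebra_simps)
    also have "X * ln (X / Y) = X * ln X - X * ln Y"
      using X Y by (cases "X = 0") (auto simp: ln_div algebra_simps)
    finally have "0 \<le> (X * ln X - X * ln Y - X + Y) / \<epsilon>" using e by simp
    also have "\<dots> = (X * ln X / \<epsilon> - Y * ln Y / \<epsilon> + ln Y * (x - y)) + (x - y)"
    proof -
      have *: "X = Y - \<epsilon> * (x - y)" by (simp add: X_def Y_def algebra_simps)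
      have "X * ln X - X * ln Y - X + Y = X * ln X - Y * ln Y + \<epsilon> * (ln Y * (x - y) + (x - y))"
      proof -
        have "X * ln Y = Y * ln Y - \<epsilon> * (ln Y * (x - y))" unfolding * by (simp add: algebra_simps)
        with * show ?thesis by (simp add: algebra_simps)
      qed
      then show ?thesis using e by (simp only: add_divide_distrib diff_divide_distrib) simp
    qed
    finally have "0 \<le> (X * ln X / \<epsilon> - Y * ln Y / \<epsilon> + ln Y * (x - y)) + (x - y)" .
    moreover have Px: "Phi \<epsilon> x = x * ln x + X * ln X / \<epsilon>" using Phi_closed_form[OF e x] by (simp add: X_def)
    moreover have Py: "Phi \<epsilon> y = y * ln y + Y * ln Y / \<epsilon>" using Phi_closed_form[OF e, of y] y by (simp add: Y_def)
    moreover have lp: "ln (phi \<epsilon> y) = ln y - ln Y" using y Y by (simp add: phi_def Y_def ln_div)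
    ultimately show ?thesis unfolding lnxy Px Py lp by (simp add: algebra_simps)
  qed
qed

text \<open>
  This is convexity of \<open>Phi \<epsilon>\<close> between \<open>0\<close> and \<open>1/\<epsilon>\<close>.  It is one half of the integrability of the
  entropy density of \<open>f\<close>; the other half is the Bregman inequality.
\<close>

lemma Phi_le_linear:
  assumes e: "0 < \<epsilon>" and x: "0 \<le> x" "\<epsilon> * x \<le> 1"
  shows "Phi \<epsilon> x \<le> x * ln (1 / \<epsilon>)"
proof -
  have "x * ln x \<le> x * ln (1 / \<epsilon>)"
  proof (cases "x = 0")
    case False
    with x e have "ln x \<le> ln (1 / \<epsilon>)" by (subst ln_le_cancel_iff) (auto simp: field_simps)
    then show ?thesis using x by (intro mult_left_mono)
  qed simp
  moreover have "(1 - \<epsilon> * x) * ln (1 - \<epsilon> * x) / \<epsilon> \<le> 0"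
  proof (cases "\<epsilon> * x = 1")
    case False
    then have "ln (1 - \<epsilon> * x) \<le> 0" using x e by (subst ln_le_zero_iff) auto
    then show ?thesis using x e by (intro divide_nonpos_pos mult_nonneg_nonpos) auto
  qed simp
  ultimately show ?thesis unfolding Phi_closed_form[OF assms] by simp
qed

text \<open>
  The map from \<open>q\<close> to \<open>m\<close> inverts the derivative \<open>ln (phi \<epsilon> m)\<close> of the entropy density.
\<close>

lemma fermi_dirac_value_bounds:
  fixes q :: real
  assumes "0 \<le> \<epsilon>"
  defines "m \<equiv> exp q / (1 + \<epsilon> * exp q)"
  shows "0 < m" "\<epsilon> * m < 1" "m \<le> exp q" "ln (phi \<epsilon> m) = q"
proof -
  have p: "0 < 1 + \<epsilon> * exp q" using assms by (intro add_pos_nonneg) auto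
  show "0 < m" using p by (simp add: m_def)
  show "\<epsilon> * m < 1" using p by (simp add: m_def)
  show "m \<le> exp q" using p assms by (simp add: m_def divide_le_eq)
  have "1 - \<epsilon> * m = 1 / (1 + \<epsilon> * exp q)" using p by (simp add: m_def field_simps)
  then have "phi \<epsilon> m = exp q" using p by (simp add: phi_def m_def)
  then show "ln (phi \<epsilon> m) = q" by simp
qed

text \<open>
  Since \<open>Phi \<epsilon> m = m q - ln (1 + \<epsilon> exp q) / \<epsilon>\<close>, both bounds are integrable functions of the velocity
  when \<open>q\<close> is a quadratic polynomial with negative leading coefficient.
\<close>

lemma Phi_fermi_dirac_value_bounds:
  fixes q :: real
  assumes e: "0 \<le> \<epsilon>"
  defines "m \<equiv> exp q / (1 + \<epsilon> * exp q)"
  shows "m * q - exp q \<le> Phi \<epsilon> m" "Phi \<epsilon> m \<le> m * q"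
proof -
  note b = fermi_dirac_value_bounds[OF e, of q, folded m_def]
  have "m * q - exp q \<le> Phi \<epsilon> m \<and> Phi \<epsilon> m \<le> m * q"
  proof (cases "\<epsilon> = 0")
    case True
    then show ?thesis by (simp add: m_def Phi_zero_closed_form)
  next
    case False
    with e have e: "\<epsilon> > 0" by simp
    define E where "E = 1 + \<epsilon> * exp q"
    have E: "E > 1" using e by (simp add: E_def)
    have Y: "1 - \<epsilon> * m = 1 / E" using E by (simp add: m_def E_def field_simps)
    have ln_m: "ln m = q - ln E" using E by (simp add: m_def E_def[symmetric] ln_div)
    have "Phi \<epsilon> m = m * ln m + 1 / E * ln (1 / E) / \<epsilon>"
      using Phi_closed_form[OF e, of m] b unfolding Y by simp
    also have "\<dots> = m * q - (m + 1 / E / \<epsilon>) * ln E"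
      unfolding ln_m using E by (simp add: ln_div right_diff_distrib distrib_right)
    also have "m + 1 / E / \<epsilon> = 1 / \<epsilon>" using E e Y by (simp add: field_simps)
    finally have "Phi \<epsilon> m = m * q - ln E / \<epsilon>" by simp
    moreover have "0 \<le> ln E" using E by simp
    moreover have "ln E \<le> \<epsilon> * exp q" using ln_le_minus_one[of E] E by (simp add: E_def)
    ultimately have "Phi \<epsilon> m = m * q - ln E / \<epsilon>" "0 \<le> ln E / \<epsilon>" "ln E / \<epsilon> \<le> exp q"
      using e by (simp_all add: pos_divide_le_eq mult.commute)
    then show ?thesis by linarith
  qed
  then show "m * q - exp q \<le> Phi \<epsilon> m" "Phi \<epsilon> m \<le> m * q" by auto
qed

section \<open>Gaussian integrals\<close>

lemma lborel_integral_affine: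
  fixes f :: "'a::euclidean_space \<Rightarrow> 'b::{banach, second_countable_topology}"
  assumes [measurable]: "f \<in> borel_measurable borel" and c: "c \<noteq> 0"
  shows "(\<integral>x. f x \<partial>lborel) = \<bar>c\<bar> ^ DIM('a) *\<^sub>R (\<integral>x. f (t + c *\<^sub>R x) \<partial>lborel)"
  by (subst lborel_affine[OF c, of t]) (simp add: integral_density integral_distr)

lemma lborel_integrable_translate:
  fixes f :: "'a::euclidean_space \<Rightarrow> 'b::{banach, second_countable_topology}"
  assumes f: "integrable lborel f"
  shows "integrable lborel (\<lambda>x. f (x - u))"
proof -
  have [measurable]: "f \<in> borel_measurable borel" using f by simp
  have "integrable (distr lborel borel ((+) (- u))) f"
    using f by (simp add: lborel_distr_plus)
  then have "integrable lborel (\<lambda>x. f (- u + x))" by (subst (asm) integrable_distr_eq) auto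
  then show ?thesis by simp
qed

lemma integrable_exp_neg_norm_square:
  assumes c: "0 < c"
  shows "integrable lborel (\<lambda>x::'a::euclidean_space. exp (- c * (norm x)\<^sup>2))"
proof -
  define \<sigma> where "\<sigma> = sqrt (1 / (2 * c))"
  have s: "\<sigma> > 0" "2 * \<sigma>\<^sup>2 = 1 / c" using c by (auto simp: \<sigma>_def)
  have "integrable lborel (\<lambda>x. sqrt (2 * pi * \<sigma>\<^sup>2) * normal_density 0 \<sigma> x)"
    using s by (intro integrable_mult_right) simp
  also have "(\<lambda>x. sqrt (2 * pi * \<sigma>\<^sup>2) * normal_density 0 \<sigma> x) = (\<lambda>x. exp (- c * x\<^sup>2))"
    using s by (auto simp: normal_density_def)
  finally have one: "integrable lborel (\<lambda>x::real. exp (- c * x\<^sup>2))" .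
  have prod: "exp (- c * (norm x)\<^sup>2) = (\<Prod>b\<in>Basis. exp (- c * (x \<bullet> b)\<^sup>2))" for x :: 'a
  proof -
    have "(norm x)\<^sup>2 = (\<Sum>b\<in>Basis. (x \<bullet> b)\<^sup>2)"
      unfolding power2_norm_eq_inner by (subst euclidean_inner) (simp add: power2_eq_square)
    then show ?thesis by (simp add: exp_sum[symmetric] sum_distrib_left)
  qed
  have "(\<integral>\<^sup>+x. ennreal (exp (- c * (norm (x::'a))\<^sup>2)) \<partial>lborel)
      = (\<integral>\<^sup>+x. (\<Prod>b\<in>Basis. ennreal (exp (- c * ((x::'a) \<bullet> b)\<^sup>2))) \<partial>lborel)"
    unfolding prod by (simp add: prod_ennreal)
  also have "\<dots> = (\<Prod>b\<in>(Basis::'a set). (\<integral>\<^sup>+x. ennreal (exp (- c * x\<^sup>2)) \<partial>lborel))"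
    by (rule nn_integral_lborel_prod) auto
  also have "\<dots> < \<infinity>"
    using one by (simp add: nn_integral_eq_integral ennreal_power)
  finally show ?thesis by (intro integrableI_bounded) auto
qed

text \<open>
  Half of the exponential decay absorbs the polynomial weight.
\<close>

lemma one_plus_exp_neg_bound:
  fixes y c :: real
  assumes "0 < c" "0 \<le> y"
  shows "exp (- c * y) * (1 + y) \<le> (1 + 2 / c) * exp (- (c / 2) * y)"
proof -
  have "(1 + 2 / c) * (1 + c / 2 * y) = 1 + y + c / 2 * y + 2 / c"
    using assms by (simp add: field_simps)
  moreover have "0 \<le> c / 2 * y" "0 \<le> 2 / c" using assms by simp_all
  ultimately have "1 + y \<le> (1 + 2 / c) * (1 + c / 2 * y)" by linarith
  also have "\<dots> \<le> (1 + 2 / c) * exp (c / 2 * y)"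
    using assms by (intro mult_left_mono exp_ge_add_one_self) auto
  finally have "exp (- c * y) * (1 + y) \<le> exp (- c * y) * ((1 + 2 / c) * exp (c / 2 * y))" by simp
  also have "\<dots> = (1 + 2 / c) * (exp (- c * y) * exp (c / 2 * y))" by (simp only: mult_ac)
  also have "exp (- c * y) * exp (c / 2 * y) = exp (- (c / 2) * y)"
    unfolding exp_add[symmetric] by (simp add: field_simps)
  finally show ?thesis .
qed

lemma integrable_exp_neg_norm_square_weight:
  assumes c: "0 < c"
  shows "integrable lborel (\<lambda>x::'a::euclidean_space. exp (- c * (norm x)\<^sup>2) * (1 + (norm x)\<^sup>2))"
proof (rule Bochner_Integration.integrable_bound)
  show "integrable lborel (\<lambda>x::'a. (1 + 2 / c) * exp (- (c / 2) * (norm x)\<^sup>2))"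
    using c by (intro integrable_mult_right integrable_exp_neg_norm_square) auto
  show "AE x::'a in lborel. norm (exp (- c * (norm x)\<^sup>2) * (1 + (norm x)\<^sup>2))
      \<le> norm ((1 + 2 / c) * exp (- (c / 2) * (norm x)\<^sup>2))"
    using one_plus_exp_neg_bound[OF c, of "(norm (x::'a))\<^sup>2" for x] c by (simp add: abs_mult)
qed simp

lemma one_plus_norm_square_add_le:
  fixes x y :: "'a::real_normed_vector"
  shows "1 + (norm (x + y))\<^sup>2 \<le> (1 + 2 * (norm x)\<^sup>2) * (2 * (1 + (norm y)\<^sup>2))"
proof -
  have "(norm (x + y))\<^sup>2 \<le> (norm x + norm y)\<^sup>2" by (intro power_mono norm_triangle_ineq) auto
  also have "\<dots> \<le> 2 * (norm x)\<^sup>2 + 2 * (norm y)\<^sup>2"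
    using sum_squares_bound[of "norm x" "norm y"] by (simp add: power2_sum)
  finally have "1 + (norm (x + y))\<^sup>2 \<le> 2 * (norm x)\<^sup>2 + 2 * (norm y)\<^sup>2 + 1" by simp
  moreover have "(1 + 2 * (norm x)\<^sup>2) * (2 * (1 + (norm y)\<^sup>2))
      = 2 + 2 * (norm y)\<^sup>2 + 4 * (norm x)\<^sup>2 + 4 * ((norm x)\<^sup>2 * (norm y)\<^sup>2)"
    by (simp add: algebra_simps)
  moreover have "0 \<le> (norm x)\<^sup>2 * (norm y)\<^sup>2" "0 \<le> (norm x)\<^sup>2" by simp_all
  ultimately show ?thesis by linarith
qed

lemma integrable_gaussian_weight:
  fixes u :: "'a::euclidean_space"
  assumes b: "b < 0"
  shows "integrable lborel (\<lambda>v. exp (a + b * (norm (v - u))\<^sup>2) * (1 + (norm v)\<^sup>2))"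
proof (rule Bochner_Integration.integrable_bound)
  let ?K = "exp a * (1 + 2 * (norm u)\<^sup>2) * 2"
  show "integrable lborel (\<lambda>v::'a. ?K * (exp (- (- b) * (norm (v - u))\<^sup>2) * (1 + (norm (v - u))\<^sup>2)))"
    using b by (intro integrable_mult_right lborel_integrable_translate integrable_exp_neg_norm_square_weight
        [where 'a='a]) auto
  show "AE v in lborel. norm (exp (a + b * (norm (v - u))\<^sup>2) * (1 + (norm v)\<^sup>2))
      \<le> norm (?K * (exp (- (- b) * (norm (v - u))\<^sup>2) * (1 + (norm (v - u))\<^sup>2)))"
  proof (rule AE_I2)
    fix v :: 'a
    have "1 + (norm v)\<^sup>2 \<le> (1 + 2 * (norm u)\<^sup>2) * (2 * (1 + (norm (v - u))\<^sup>2))"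
      using one_plus_norm_square_add_le[of u "v - u"] by simp
    then have "exp (a + b * (norm (v - u))\<^sup>2) * (1 + (norm v)\<^sup>2)
      \<le> exp (a + b * (norm (v - u))\<^sup>2) * ((1 + 2 * (norm u)\<^sup>2) * (2 * (1 + (norm (v - u))\<^sup>2)))"
      by (rule mult_left_mono) simp
    also have "\<dots> = ?K * (exp (- (- b) * (norm (v - u))\<^sup>2) * (1 + (norm (v - u))\<^sup>2))"
      by (simp add: exp_add)
    finally show "norm (exp (a + b * (norm (v - u))\<^sup>2) * (1 + (norm v)\<^sup>2))
      \<le> norm (?K * (exp (- (- b) * (norm (v - u))\<^sup>2) * (1 + (norm (v - u))\<^sup>2)))"
      by simp
  qed
qed simp

lemma lborel_integral_pos:
  fixes f :: "'a::euclidean_space \<Rightarrow> real"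
  assumes f: "integrable lborel f" and pos: "AE x in lborel. 0 < f x"
  shows "0 < (\<integral>x. f x \<partial>lborel)"
proof -
  have nn: "AE x in lborel. 0 \<le> f x" using pos by eventually_elim simp
  have "(\<integral>x. f x \<partial>lborel) \<noteq> 0"
  proof
    assume "(\<integral>x. f x \<partial>lborel) = 0"
    with f nn have "AE x in lborel. f x = 0" by (simp add: integral_nonneg_eq_0_iff_AE)
    with pos have "AE x in (lborel :: 'a measure). False" by eventually_elim simp
    then show False by (simp add: AE_iff_null null_sets_def)
  qed
  with integral_nonneg_AE[OF nn] show ?thesis by simp
qed

section \<open>Moments of the standard Fermi-Dirac profile\<close>

text \<open>
  Every Fermi-Dirac distribution is a translated and rescaled copy of such a profile.
\<close>

definition fd_profile :: "real \<Rightarrow> real \<Rightarrow> real^3 \<Rightarrow> real" where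
  "fd_profile \<epsilon> a z = exp (a - (norm z)\<^sup>2) / (1 + \<epsilon> * exp (a - (norm z)\<^sup>2))"

definition fd_moment :: "nat \<Rightarrow> real \<Rightarrow> real \<Rightarrow> real" where
  "fd_moment k \<epsilon> a = (\<integral>z. fd_profile \<epsilon> a z * norm z ^ k \<partial>lborel)"

lemma fd_profile_measurable [measurable]: "fd_profile \<epsilon> a \<in> borel_measurable borel"
  unfolding fd_profile_def by measurable

lemma fd_profile_bounds:
  assumes "0 \<le> \<epsilon>"
  shows "0 < fd_profile \<epsilon> a z" "fd_profile \<epsilon> a z \<le> exp a * exp (- (norm z)\<^sup>2)"
  using fermi_dirac_value_bounds[OF assms, of "a - (norm z)\<^sup>2"]
  by (auto simp: fd_profile_def exp_diff exp_minus field_simps)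

lemma power_le_one_plus_square:
  fixes x :: real
  assumes "0 \<le> x" "k \<le> 2"
  shows "x ^ k \<le> 1 + x\<^sup>2"
proof -
  consider "k = 0" | "k = 1" | "k = 2" using assms by linarith
  then show ?thesis
  proof cases
    case 2
    have "0 \<le> (x - 1)\<^sup>2" by simp
    then show ?thesis using 2 assms by (simp add: power2_eq_square algebra_simps)
  qed (use assms in auto)
qed

lemma fd_profile_power_le:
  assumes "0 \<le> \<epsilon>" "k \<le> 2"
  shows "fd_profile \<epsilon> a z * norm z ^ k \<le> exp a * (exp (- 1 * (norm z)\<^sup>2) * (1 + (norm z)\<^sup>2))"
proof -
  have "fd_profile \<epsilon> a z * norm z ^ k \<le> (exp a * exp (- (norm z)\<^sup>2)) * (1 + (norm z)\<^sup>2)"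
    using assms fd_profile_bounds[OF assms(1), of a z]
    by (intro mult_mono power_le_one_plus_square) auto
  then show ?thesis by (simp add: mult.assoc)
qed

lemma fd_profile_power_integrable:
  assumes "0 \<le> \<epsilon>" "k \<le> 2"
  shows "integrable lborel (\<lambda>z. fd_profile \<epsilon> a z * norm z ^ k)"
proof (rule Bochner_Integration.integrable_bound)
  show "integrable lborel (\<lambda>z::real^3. exp a * (exp (- 1 * (norm z)\<^sup>2) * (1 + (norm z)\<^sup>2)))"
    by (intro integrable_mult_right integrable_exp_neg_norm_square_weight) simp
  show "AE z in lborel. norm (fd_profile \<epsilon> a z * norm z ^ k)
      \<le> norm (exp a * (exp (- 1 * (norm z)\<^sup>2) * (1 + (norm z)\<^sup>2)))"
    using fd_profile_power_le[OF assms, of a] fd_profile_bounds(1)[OF assms(1), of a]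
    by (intro AE_I2) (simp add: abs_mult less_imp_le)
qed measurable

lemma fd_moment_pos:
  assumes "0 \<le> \<epsilon>" "k \<le> 2"
  shows "0 < fd_moment k \<epsilon> a"
  unfolding fd_moment_def
proof (rule lborel_integral_pos[OF fd_profile_power_integrable[OF assms]])
  have "AE z in lborel. z \<noteq> (0 :: real^3)" by (rule AE_lborel_singleton)
  then show "AE z in lborel. 0 < fd_profile \<epsilon> a z * norm z ^ k"
    by eventually_elim (use fd_profile_bounds(1)[OF assms(1)] in auto)
qed

lemma fd_moment_isCont:
  assumes e: "0 \<le> \<epsilon>" and k: "k \<le> 2"
  shows "isCont (fd_moment k \<epsilon>) a"
  unfolding continuous_at_sequentially
proof (intro allI impI)
  fix A :: "nat \<Rightarrow> real" assume A: "A \<longlonglongrightarrow> a"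
  then have eA: "(\<lambda>n. exp (A n)) \<longlonglongrightarrow> exp a" by (intro tendsto_intros)
  then have "Bseq (\<lambda>n. exp (A n))" by (rule convergent_imp_Bseq[OF convergentI])
  then obtain K where "\<forall>n. norm (exp (A n)) \<le> K" using BseqE by blast
  then have K: "exp (A n) \<le> K" for n by simp
  have "(\<lambda>n. \<integral>z. fd_profile \<epsilon> (A n) z * norm z ^ k \<partial>lborel)
      \<longlonglongrightarrow> (\<integral>z. fd_profile \<epsilon> a z * norm z ^ k \<partial>lborel)"
  proof (rule integral_dominated_convergence)
    show "integrable lborel (\<lambda>z::real^3. K * (exp (- 1 * (norm z)\<^sup>2) * (1 + (norm z)\<^sup>2)))"
      by (intro integrable_mult_right integrable_exp_neg_norm_square_weight) simp
    show "AE z in lborel. (\<lambda>n. fd_profile \<epsilon> (A n) z * norm z ^ k) \<longlonglongrightarrow> fd_profile \<epsilon> a z * norm z ^ k"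
    proof (rule AE_I2)
      fix z :: "real^3"
      have "1 + \<epsilon> * exp (a - (norm z)\<^sup>2) \<noteq> 0"
        using e by (metis add_pos_nonneg exp_ge_zero less_irrefl mult_nonneg_nonneg zero_less_one)
      then show "(\<lambda>n. fd_profile \<epsilon> (A n) z * norm z ^ k) \<longlonglongrightarrow> fd_profile \<epsilon> a z * norm z ^ k"
        unfolding fd_profile_def by (intro tendsto_intros A)
    qed
    fix n
    show "AE z in lborel. norm (fd_profile \<epsilon> (A n) z * norm z ^ k)
        \<le> K * (exp (- 1 * (norm z)\<^sup>2) * (1 + (norm z)\<^sup>2))"
    proof (rule AE_I2)
      fix z :: "real^3"
      have "norm (fd_profile \<epsilon> (A n) z * norm z ^ k) = fd_profile \<epsilon> (A n) z * norm z ^ k"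
        using fd_profile_bounds(1)[OF e, of "A n" z] by simp
      also have "\<dots> \<le> exp (A n) * (exp (- 1 * (norm z)\<^sup>2) * (1 + (norm z)\<^sup>2))"
        by (rule fd_profile_power_le[OF e k])
      also have "\<dots> \<le> K * (exp (- 1 * (norm z)\<^sup>2) * (1 + (norm z)\<^sup>2))"
        by (intro mult_right_mono K) auto
      finally show "norm (fd_profile \<epsilon> (A n) z * norm z ^ k) \<le> K * (exp (- 1 * (norm z)\<^sup>2) * (1 + (norm z)\<^sup>2))" .
    qed
  qed measurable
  then show "(fd_moment k \<epsilon> \<circ> A) \<longlonglongrightarrow> fd_moment k \<epsilon> a" by (simp add: fd_moment_def o_def)
qed

lemma fd_moment_upper:
  assumes "0 \<le> \<epsilon>" "k \<le> 2"
  shows "fd_moment k \<epsilon> a \<le> exp a * fd_moment k 0 0"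
proof -
  have "fd_moment k \<epsilon> a \<le> (\<integral>z. exp a * (fd_profile 0 0 z * norm z ^ k) \<partial>lborel)"
    unfolding fd_moment_def
  proof (rule integral_mono)
    fix z :: "real^3"
    have "fd_profile \<epsilon> a z \<le> exp a * fd_profile 0 0 z"
      using fd_profile_bounds(2)[OF assms(1), of a z] by (simp add: fd_profile_def)
    then show "fd_profile \<epsilon> a z * norm z ^ k \<le> exp a * (fd_profile 0 0 z * norm z ^ k)"
      by (metis mult.assoc mult_right_mono norm_ge_zero zero_le_power)
  qed (use assms in \<open>auto intro!: fd_profile_power_integrable\<close>)
  then show ?thesis by (simp add: fd_moment_def)
qed

lemma fd_moment_lower:
  assumes "0 \<le> \<epsilon>" "k \<le> 2" "a \<le> 0"
  shows "exp a * fd_moment k 0 0 / (1 + \<epsilon>) \<le> fd_moment k \<epsilon> a"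
proof -
  have "(\<integral>z. exp a / (1 + \<epsilon>) * (fd_profile 0 0 z * norm z ^ k) \<partial>lborel) \<le> fd_moment k \<epsilon> a"
    unfolding fd_moment_def
  proof (rule integral_mono)
    fix z :: "real^3"
    have "a - (norm z)\<^sup>2 \<le> 0" using assms(3) zero_le_power2[of "norm z"] by linarith
    then have "exp (a - (norm z)\<^sup>2) \<le> 1" by simp
    then have le: "1 + \<epsilon> * exp (a - (norm z)\<^sup>2) \<le> 1 + \<epsilon>" using assms
      by (metis add_left_mono mult.right_neutral mult_left_mono)
    have "exp a / (1 + \<epsilon>) * fd_profile 0 0 z = exp (a - (norm z)\<^sup>2) / (1 + \<epsilon>)"
      by (simp add: fd_profile_def exp_diff exp_minus field_simps)
    also have "\<dots> \<le> fd_profile \<epsilon> a z"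
      unfolding fd_profile_def using le assms by (intro divide_left_mono) (auto intro!: mult_pos_pos add_pos_nonneg)
    finally show "exp a / (1 + \<epsilon>) * (fd_profile 0 0 z * norm z ^ k) \<le> fd_profile \<epsilon> a z * norm z ^ k"
      by (metis mult.assoc mult_right_mono norm_ge_zero zero_le_power)
  qed (use assms in \<open>auto intro!: fd_profile_power_integrable\<close>)
  then show ?thesis by (simp add: fd_moment_def)
qed

text \<open>
  With \<open>x = exp a\<close> small, \<open>fd_moment 0 \<epsilon> a ^ 5\<close> is of order \<open>x\<^sup>5\<close> but \<open>fd_moment 2 \<epsilon> a ^ 3\<close> of order
  \<open>x\<^sup>3\<close>.
\<close>

lemma fd_moment_ratio_dilute:
  assumes e: "0 \<le> \<epsilon>" and \<theta>: "0 < \<theta>"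
  shows "\<exists>a. \<theta> * fd_moment 0 \<epsilon> a ^ 5 < fd_moment 2 \<epsilon> a ^ 3"
proof -
  define C0 C2 where "C0 = fd_moment 0 0 0" and "C2 = fd_moment 2 0 0"
  have C: "C0 > 0" "C2 > 0" by (auto simp: C0_def C2_def fd_moment_pos)
  define K where "K = (C2 / (1 + \<epsilon>)) ^ 3 / (\<theta> * C0 ^ 5)"
  have K: "K > 0" using C e \<theta> by (auto simp: K_def)
  define x where "x = min 1 (K / 2)"
  have x: "0 < x" "x \<le> 1" "x < K" using K by (auto simp: x_def min_def)
  have "x\<^sup>2 \<le> x" using x by (simp add: power2_eq_square mult_left_le)
  with x have x2: "x\<^sup>2 < K" by linarith
  have ex: "exp (ln x) = x" and lx: "ln x \<le> 0" using x by auto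
  have u: "fd_moment 0 \<epsilon> (ln x) \<le> x * C0"
    using fd_moment_upper[OF e, of 0 "ln x"] x by (simp add: C0_def)
  have l: "x * (C2 / (1 + \<epsilon>)) \<le> fd_moment 2 \<epsilon> (ln x)"
    using fd_moment_lower[OF e, of 2 "ln x"] x lx by (simp add: C2_def)
  have "\<theta> * fd_moment 0 \<epsilon> (ln x) ^ 5 \<le> \<theta> * (x * C0) ^ 5"
    using \<theta> u fd_moment_pos[OF e, of 0 "ln x"] by (intro mult_left_mono power_mono) auto
  also have "\<dots> = x ^ 3 * (x\<^sup>2 * (\<theta> * C0 ^ 5))" by (simp add: power_mult_distrib eval_nat_numeral)
  also have "\<dots> < x ^ 3 * (K * (\<theta> * C0 ^ 5))"
    using x x2 C \<theta> by (intro mult_strict_left_mono mult_strict_right_mono) auto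
  also have "K * (\<theta> * C0 ^ 5) = (C2 / (1 + \<epsilon>)) ^ 3" using C \<theta> by (simp add: K_def)
  also have "x ^ 3 * (C2 / (1 + \<epsilon>)) ^ 3 = (x * (C2 / (1 + \<epsilon>))) ^ 3" by (simp only: power_mult_distrib)
  also have "\<dots> \<le> fd_moment 2 \<epsilon> (ln x) ^ 3"
    using l x C e by (intro power_mono) auto
  finally show ?thesis by blast
qed

lemma ball_norm_power_measurable:
  "(\<lambda>y::real^3. indicator (ball 0 r) y * norm y ^ k :: real) \<in> borel_measurable borel"
  by (intro borel_measurable_times borel_measurable_indicator) auto

text \<open>
  Let \<open>J\<close> be the second moment and \<open>V\<close> the volume of the unit ball.  By scaling, the ball of radius
  \<open>s < 1\<close> has second moment \<open>s\<^sup>5 J\<close> and volume \<open>s\<^sup>3 V\<close>.  On the shell between the two balls the norm is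
  at most \<open>1\<close>, so \<open>J (1 - s\<^sup>5) \<le> V (1 - s\<^sup>3)\<close>.  Let \<open>s\<close> tend to \<open>1\<close>.
\<close>

lemma ball_second_moment_le:
  "(\<integral>y. indicator (ball 0 1) y * (norm (y::real^3))\<^sup>2 \<partial>lborel) \<le> 3 / 5 * measure lborel (ball (0::real^3) 1)"
proof -
  define J where "J r = (\<integral>y. indicator (ball 0 r) y * (norm (y::real^3))\<^sup>2 \<partial>lborel)" for r :: real
  define V where "V r = measure lborel (ball (0::real^3) r)" for r
  have V: "V r = r ^ 3 * V 1" if "r \<ge> 0" for r
    using that by (simp add: V_def sphere_volume)
  have int_ind: "integrable lborel (indicator (ball (0::real^3) r) :: _ \<Rightarrow> real)" for r
    by (intro integrable_real_indicator emeasure_bounded_finite) auto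
  have int: "integrable lborel (\<lambda>y::real^3. indicator (ball 0 r) y * (norm y)\<^sup>2 :: real)" for r :: real
  proof (rule Bochner_Integration.integrable_bound)
    show "integrable lborel (\<lambda>y::real^3. r\<^sup>2 * indicator (ball 0 r) y :: real)"
      by (intro integrable_mult_right int_ind)
    show "AE y in lborel. norm (indicator (ball 0 r) y * (norm (y::real^3))\<^sup>2 :: real)
        \<le> norm (r\<^sup>2 * indicator (ball 0 r) y :: real)"
      by (intro AE_I2) (auto simp: indicator_def intro!: power_mono)
  qed (simp add: ball_norm_power_measurable)
  have J: "J r = r ^ 5 * J 1" if r: "r > 0" for r
  proof -
    have "J r = \<bar>r\<bar> ^ DIM(real^3) *\<^sub>R
        (\<integral>y. indicator (ball 0 r) (0 + r *\<^sub>R y) * (norm (0 + r *\<^sub>R (y::real^3)))\<^sup>2 \<partial>lborel)"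
      unfolding J_def using r by (intro lborel_integral_affine ball_norm_power_measurable) auto
    also have "(\<lambda>y::real^3. indicator (ball 0 r) (0 + r *\<^sub>R y) * (norm (0 + r *\<^sub>R y))\<^sup>2 :: real)
        = (\<lambda>y. r\<^sup>2 * (indicator (ball 0 1) y * (norm y)\<^sup>2))"
      using r by (auto simp: indicator_def power_mult_distrib)
    finally show ?thesis using r by (simp add: J_def eval_nat_numeral)
  qed
  have shell: "J 1 * (1 - s ^ 5) \<le> V 1 * (1 - s ^ 3)" if s: "0 < s" "s < 1" for s
  proof -
    have "J 1 - J s = (\<integral>y. indicator (ball 0 1) y * (norm (y::real^3))\<^sup>2
        - indicator (ball 0 s) y * (norm y)\<^sup>2 \<partial>lborel)"
      unfolding J_def by (rule Bochner_Integration.integral_diff[symmetric]) (rule int)+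
    also have "\<dots> \<le> (\<integral>y. indicator (ball (0::real^3) 1) y - indicator (ball 0 s) y \<partial>lborel)"
    proof (rule integral_mono)
      fix y :: "real^3"
      show "indicator (ball 0 1) y * (norm y)\<^sup>2 - indicator (ball 0 s) y * (norm y)\<^sup>2
          \<le> indicator (ball 0 1) y - (indicator (ball 0 s) y :: real)"
        using s by (auto simp: indicator_def power_le_one)
    qed (intro Bochner_Integration.integrable_diff int int_ind)+
    also have "\<dots> = V 1 - V s"
      unfolding V_def by (subst Bochner_Integration.integral_diff[OF int_ind int_ind]) simp
    finally show ?thesis using J[of s] V[of s] s by (simp add: algebra_simps)
  qed
  have "((\<lambda>s::real. V 1 * ((1 - s ^ 3) / (1 - s ^ 5))) \<longlongrightarrow> V 1 * (3 / 5)) (at_left 1)"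
  proof (rule tendsto_mult[OF tendsto_const])
    show "((\<lambda>s::real. (1 - s ^ 3) / (1 - s ^ 5)) \<longlongrightarrow> 3 / 5) (at_left 1)" by real_asymp
  qed
  moreover have "\<forall>\<^sub>F s in at_left (1::real). J 1 \<le> V 1 * ((1 - s ^ 3) / (1 - s ^ 5))"
  proof (rule eventually_at_leftI[of 0])
    fix s :: real assume s: "s \<in> {0<..<1}"
    then have "s ^ 5 < 1" by (simp add: power_less_one_iff)
    with shell[of s] s show "J 1 \<le> V 1 * ((1 - s ^ 3) / (1 - s ^ 5))"
      by (simp add: pos_le_divide_eq)
  qed simp
  ultimately have "J 1 \<le> V 1 * (3 / 5)" by (intro tendsto_lowerbound) auto
  then show ?thesis by (simp add: J_def V_def mult.commute)
qed

lemma fd_moment_rescale: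
  assumes a: "0 < a"
  shows "fd_moment k \<epsilon> a = sqrt a ^ (3 + k) * (\<integral>y. fd_profile \<epsilon> a (sqrt a *\<^sub>R y) * norm y ^ k \<partial>lborel)"
proof -
  have "fd_moment k \<epsilon> a = \<bar>sqrt a\<bar> ^ DIM(real^3) *\<^sub>R
      (\<integral>y. fd_profile \<epsilon> a (0 + sqrt a *\<^sub>R y) * norm (0 + sqrt a *\<^sub>R y) ^ k \<partial>lborel)"
    unfolding fd_moment_def using a by (intro lborel_integral_affine) auto
  also have "(\<lambda>y. fd_profile \<epsilon> a (0 + sqrt a *\<^sub>R y) * norm (0 + sqrt a *\<^sub>R y) ^ k)
      = (\<lambda>y. sqrt a ^ k * (fd_profile \<epsilon> a (sqrt a *\<^sub>R y) * norm y ^ k))"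
    using a by (auto simp: power_mult_distrib)
  finally show ?thesis using a by (simp add: power_add)
qed

text \<open>
  At the scale of the Fermi radius \<open>sqrt a\<close> the profile tends to \<open>1/\<epsilon>\<close> inside the unit ball and to
  \<open>0\<close> outside.
\<close>

lemma fd_moment_dense_limit:
  assumes e: "0 < \<epsilon>" and k: "k \<le> 2"
  shows "((\<lambda>a. \<integral>y. fd_profile \<epsilon> a (sqrt a *\<^sub>R y) * norm y ^ k \<partial>lborel)
    \<longlongrightarrow> (\<integral>y. 1 / \<epsilon> * (indicator (ball 0 1) y * norm (y::real^3) ^ k) \<partial>lborel)) at_top"
proof (rule integral_dominated_convergence_at_top)
  show "integrable lborel (\<lambda>y::real^3. (1 / \<epsilon> + 1) * exp 1 * (exp (- 1 * (norm y)\<^sup>2) * (1 + (norm y)\<^sup>2)))"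
    by (intro integrable_mult_right integrable_exp_neg_norm_square_weight) simp
  have prof: "fd_profile \<epsilon> a (sqrt a *\<^sub>R y) = exp (a * (1 - (norm y)\<^sup>2)) / (1 + \<epsilon> * exp (a * (1 - (norm y)\<^sup>2)))"
    if "a > 0" for a y
    using that by (simp add: fd_profile_def power_mult_distrib algebra_simps)
  show "AE y in lborel. ((\<lambda>a. fd_profile \<epsilon> a (sqrt a *\<^sub>R y) * norm y ^ k)
      \<longlongrightarrow> 1 / \<epsilon> * (indicator (ball 0 1) y * norm (y::real^3) ^ k)) at_top"
  proof -
    have "sphere (0::real^3) 1 \<in> null_sets lborel"
      using negligible_sphere[of "0::real^3" 1] by (simp add: negligible_iff_null_sets null_sets_completion_iff)
    then have "AE y in lborel. y \<notin> sphere (0::real^3) 1" by (rule AE_not_in)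
    then show ?thesis
    proof eventually_elim
      case (elim y)
      define c where "c = 1 - (norm y)\<^sup>2"
      have "((\<lambda>a. exp (a * c) / (1 + \<epsilon> * exp (a * c))) \<longlongrightarrow> 1 / \<epsilon> * indicator (ball 0 1) y) at_top"
      proof (cases "norm y < 1")
        case True
        then have "c > 0" by (simp add: c_def power_less_one_iff)
        with e have "((\<lambda>a. exp (a * c) / (1 + \<epsilon> * exp (a * c))) \<longlongrightarrow> inverse \<epsilon>) at_top"
          by real_asymp
        with True show ?thesis by (simp add: inverse_eq_divide)
      next
        case False
        with elim have "norm y > 1" by simp
        then have "c < 0" by (simp add: c_def one_less_power)
        with e have "((\<lambda>a. exp (a * c) / (1 + \<epsilon> * exp (a * c))) \<longlongrightarrow> 0) at_top"
          by real_asymp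
        with False show ?thesis by simp
      qed
      moreover have "\<forall>\<^sub>F a in at_top. exp (a * c) / (1 + \<epsilon> * exp (a * c)) = fd_profile \<epsilon> a (sqrt a *\<^sub>R y)"
        using eventually_gt_at_top[of 0] by eventually_elim (simp add: prof c_def)
      ultimately have "((\<lambda>a. fd_profile \<epsilon> a (sqrt a *\<^sub>R y)) \<longlongrightarrow> 1 / \<epsilon> * indicator (ball 0 1) y) at_top"
        by (rule Lim_transform_eventually)
      from tendsto_mult[OF this tendsto_const[of "norm y ^ k"]] show ?case by (simp add: mult.assoc)
    qed
  qed
  show "\<forall>\<^sub>F a in at_top. AE y in lborel. norm (fd_profile \<epsilon> a (sqrt a *\<^sub>R y) * norm y ^ k)
      \<le> (1 / \<epsilon> + 1) * exp 1 * (exp (- 1 * (norm (y::real^3))\<^sup>2) * (1 + (norm y)\<^sup>2))"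
    using eventually_ge_at_top[of 1]
  proof eventually_elim
    case (elim a)
    show ?case
    proof (rule AE_I2)
      fix y :: "real^3"
      define c where "c = 1 - (norm y)\<^sup>2"
      have "exp (a * c) / (1 + \<epsilon> * exp (a * c)) \<le> (1 / \<epsilon> + 1) * exp c"
      proof (cases "c \<ge> 0")
        case True
        have "exp (a * c) / (1 + \<epsilon> * exp (a * c)) \<le> 1 / \<epsilon>"
          using e by (simp add: divide_simps add_pos_pos)
        also have "\<dots> \<le> (1 / \<epsilon> + 1) * 1" by simp
        also have "\<dots> \<le> (1 / \<epsilon> + 1) * exp c" using True e by (intro mult_left_mono) auto
        finally show ?thesis .
      next
        case False
        then have "a * c \<le> 1 * c" using elim by (intro mult_right_mono_neg) auto
        have "exp (a * c) / (1 + \<epsilon> * exp (a * c)) \<le> exp (a * c)"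
          using fermi_dirac_value_bounds(3)[of \<epsilon> "a * c"] e by simp
        also have "\<dots> \<le> 1 * exp c" using \<open>a * c \<le> 1 * c\<close> by simp
        also have "\<dots> \<le> (1 / \<epsilon> + 1) * exp c" using e by (intro mult_right_mono) auto
        finally show ?thesis .
      qed
      then have "fd_profile \<epsilon> a (sqrt a *\<^sub>R y) \<le> (1 / \<epsilon> + 1) * exp 1 * exp (- 1 * (norm y)\<^sup>2)"
        using elim by (simp add: prof c_def exp_diff exp_minus field_simps)
      then have "fd_profile \<epsilon> a (sqrt a *\<^sub>R y) * norm y ^ k
          \<le> ((1 / \<epsilon> + 1) * exp 1 * exp (- 1 * (norm y)\<^sup>2)) * (1 + (norm y)\<^sup>2)"
        using e k by (intro mult_mono power_le_one_plus_square) auto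
      moreover have "0 \<le> fd_profile \<epsilon> a (sqrt a *\<^sub>R y) * norm y ^ k"
        using fd_profile_bounds(1)[of \<epsilon> a "sqrt a *\<^sub>R y"] e by simp
      ultimately show "norm (fd_profile \<epsilon> a (sqrt a *\<^sub>R y) * norm y ^ k)
          \<le> (1 / \<epsilon> + 1) * exp 1 * (exp (- 1 * (norm y)\<^sup>2) * (1 + (norm y)\<^sup>2))"
        by (simp add: mult.assoc)
    qed
  qed
  show "(\<lambda>y::real^3. 1 / \<epsilon> * (indicator (ball 0 1) y * norm y ^ k)) \<in> borel_measurable lborel"
    using ball_norm_power_measurable by (intro borel_measurable_times[OF borel_measurable_const]) simp
  show "(\<lambda>y::real^3. fd_profile \<epsilon> a (sqrt a *\<^sub>R y) * norm y ^ k) \<in> borel_measurable lborel" for a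
    by measurable
qed

text \<open>
  For \<open>\<epsilon> > 0\<close> the powers of \<open>sqrt a\<close> in the rescaled moments cancel, since \<open>3 \<cdot> 5 = 5 \<cdot> 3\<close>.  The
  quotient therefore converges to \<open>(J/\<epsilon>)\<^sup>3 / (V/\<epsilon>)\<^sup>5\<close>, where \<open>J \<le> 3 V / 5\<close>.  For \<open>\<epsilon> = 0\<close> the quotient is
  proportional to \<open>exp (- 2 a)\<close>.
\<close>

lemma fd_moment_ratio_dense:
  assumes e: "0 \<le> \<epsilon>" and \<theta>: "27 / 125 * (\<epsilon> / (4 / 3 * pi))\<^sup>2 < \<theta>"
  shows "\<exists>a. fd_moment 2 \<epsilon> a ^ 3 < \<theta> * fd_moment 0 \<epsilon> a ^ 5"
proof (cases "\<epsilon> = 0")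
  case True
  define C0 C2 where "C0 = fd_moment 0 0 0" and "C2 = fd_moment 2 0 0"
  have C: "C0 > 0" "C2 > 0" by (auto simp: C0_def C2_def fd_moment_pos)
  have th: "\<theta> > 0" using \<theta> True by simp
  define K where "K = C2 ^ 3 / (\<theta> * C0 ^ 5)"
  define x where "x = 1 + K"
  have K: "K > 0" using C th by (simp add: K_def)
  have x: "x > 0" "K < x\<^sup>2" using K by (auto simp: x_def power2_eq_square algebra_simps intro!: add_pos_pos)
  have m: "fd_moment k 0 (ln x) = x * fd_moment k 0 0" for k
    using x by (simp add: fd_moment_def fd_profile_def exp_diff exp_minus mult.assoc divide_inverse)
  have "fd_moment 2 0 (ln x) ^ 3 = x ^ 3 * (K * (\<theta> * C0 ^ 5))"
    using C th by (simp add: m power_mult_distrib K_def C2_def)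
  also have "\<dots> < x ^ 3 * (x\<^sup>2 * (\<theta> * C0 ^ 5))"
    using x C th by (intro mult_strict_left_mono mult_strict_right_mono) auto
  also have "\<dots> = \<theta> * fd_moment 0 0 (ln x) ^ 5"
    by (simp add: m power_mult_distrib C0_def eval_nat_numeral)
  finally show ?thesis using True by blast
next
  case False
  with e have e: "\<epsilon> > 0" by simp
  define P where "P k a = (\<integral>y. fd_profile \<epsilon> a (sqrt a *\<^sub>R y) * norm y ^ k \<partial>lborel)" for k a
  define V where "V = measure lborel (ball (0::real^3) 1)"
  have V: "V = 4 / 3 * pi" by (simp add: V_def sphere_volume)
  have V0: "V > 0" by (simp add: V)
  define J where "J = (\<integral>y. indicator (ball 0 1) y * (norm (y::real^3))\<^sup>2 \<partial>lborel)"
  have J: "0 \<le> J" "J \<le> 3 / 5 * V"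
    using ball_second_moment_le by (auto simp: J_def V_def)
  have P0: "(P 0 \<longlongrightarrow> V / \<epsilon>) at_top"
    using fd_moment_dense_limit[OF e, of 0] by (simp add: P_def[abs_def] V_def)
  have P2: "(P 2 \<longlongrightarrow> J / \<epsilon>) at_top"
    using fd_moment_dense_limit[OF e, of 2] by (simp add: P_def[abs_def] J_def)
  have "((\<lambda>a. \<theta> * P 0 a ^ 5 - P 2 a ^ 3) \<longlongrightarrow> \<theta> * (V / \<epsilon>) ^ 5 - (J / \<epsilon>) ^ 3) at_top"
    by (intro tendsto_intros P0 P2)
  moreover have "0 < \<theta> * (V / \<epsilon>) ^ 5 - (J / \<epsilon>) ^ 3"
  proof -
    have "(J / \<epsilon>) ^ 3 \<le> (3 / 5 * V / \<epsilon>) ^ 3"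
      using J e by (intro power_mono divide_right_mono) auto
    also have "\<dots> = 27 / 125 * (\<epsilon> / V)\<^sup>2 * (V / \<epsilon>) ^ 5"
      using V0 e by (simp add: power_mult_distrib power_divide eval_nat_numeral)
    also have "\<dots> < \<theta> * (V / \<epsilon>) ^ 5"
      using \<theta> V0 e unfolding V[symmetric] by (intro mult_strict_right_mono) auto
    finally show ?thesis by simp
  qed
  ultimately have "\<forall>\<^sub>F a in at_top. 0 < \<theta> * P 0 a ^ 5 - P 2 a ^ 3" by (rule order_tendstoD)
  with eventually_gt_at_top[of 0] have "\<forall>\<^sub>F a in at_top. 0 < a \<and> P 2 a ^ 3 < \<theta> * P 0 a ^ 5"
    by eventually_elim simp
  then obtain a where a: "0 < a" "P 2 a ^ 3 < \<theta> * P 0 a ^ 5"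
    using eventually_happens'[of "at_top :: real filter"] by force
  have "fd_moment 2 \<epsilon> a ^ 3 = sqrt a ^ 15 * P 2 a ^ 3"
    by (simp add: fd_moment_rescale[OF a(1)] P_def power_mult_distrib flip: power_mult)
  also have "\<dots> < sqrt a ^ 15 * (\<theta> * P 0 a ^ 5)"
    using a by (intro mult_strict_left_mono) auto
  also have "\<dots> = \<theta> * fd_moment 0 \<epsilon> a ^ 5"
    by (simp add: fd_moment_rescale[OF a(1)] P_def power_mult_distrib flip: power_mult)
  finally show ?thesis by blast
qed

text \<open>
  Eliminating the length scale \<open>s\<close> from the two equations leaves
  \<open>fd_moment 2 \<epsilon> a ^ 3 = \<theta> * fd_moment 0 \<epsilon> a ^ 5\<close>.  The intermediate value theorem solves it for
  \<open>a\<close>, and the first equation then determines \<open>s\<close>.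
\<close>

lemma fd_parameters_exist:
  assumes e: "0 \<le> \<epsilon>" and \<rho>: "0 < \<rho>" and T: "0 < T"
    and dense: "(\<epsilon> * \<rho> / (4 / 3 * pi))\<^sup>2 < 125 * T ^ 3"
  obtains a s where "0 < s" "s ^ 3 * fd_moment 0 \<epsilon> a = \<rho>" "s ^ 5 * fd_moment 2 \<epsilon> a = 3 * \<rho> * T"
proof -
  define \<theta> where "\<theta> = 27 * T ^ 3 / \<rho>\<^sup>2"
  have \<theta>: "\<theta> > 0" using \<rho> T by (simp add: \<theta>_def)
  have "27 / 125 * (\<epsilon> / (4 / 3 * pi))\<^sup>2 < \<theta>"
  proof -
    have "27 / 125 * (\<epsilon> / (4 / 3 * pi))\<^sup>2 = 27 / 125 * (\<epsilon> * \<rho> / (4 / 3 * pi))\<^sup>2 / \<rho>\<^sup>2"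
      using \<rho> by (simp add: power_mult_distrib power_divide)
    also have "\<dots> < 27 / 125 * (125 * T ^ 3) / \<rho>\<^sup>2"
      using \<rho> dense by (intro divide_strict_right_mono mult_strict_left_mono) auto
    finally show ?thesis by (simp add: \<theta>_def)
  qed
  from fd_moment_ratio_dense[OF e this] obtain a1
    where a1: "fd_moment 2 \<epsilon> a1 ^ 3 - \<theta> * fd_moment 0 \<epsilon> a1 ^ 5 < 0" by auto
  from fd_moment_ratio_dilute[OF e \<theta>] obtain a2
    where a2: "0 < fd_moment 2 \<epsilon> a2 ^ 3 - \<theta> * fd_moment 0 \<epsilon> a2 ^ 5" by auto
  let ?D = "\<lambda>a. fd_moment 2 \<epsilon> a ^ 3 - \<theta> * fd_moment 0 \<epsilon> a ^ 5"
  have "continuous_on UNIV ?D"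
    by (intro continuous_intros continuous_at_imp_continuous_on ballI fd_moment_isCont e) auto
  then have "connected (range ?D)" by (rule connected_continuous_image) auto
  then have "0 \<in> range ?D"
    by (rule connectedD_interval[of _ "?D a1" "?D a2"]) (use a1 a2 in auto)
  then obtain a where a: "fd_moment 2 \<epsilon> a ^ 3 = \<theta> * fd_moment 0 \<epsilon> a ^ 5" by auto
  define I0 I2 where "I0 = fd_moment 0 \<epsilon> a" and "I2 = fd_moment 2 \<epsilon> a"
  have I: "I0 > 0" "I2 > 0" using fd_moment_pos[OF e] by (auto simp: I0_def I2_def)
  define s where "s = root 3 (\<rho> / I0)"
  have s: "s > 0" using \<rho> I by (simp add: s_def)
  have s3: "s ^ 3 = \<rho> / I0" using \<rho> I by (simp add: s_def)
  have "(s ^ 5 * I2) ^ 3 = (s ^ 3) ^ 5 * I2 ^ 3" by (simp add: power_mult_distrib flip: power_mult)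
  also have "\<dots> = \<rho> ^ 5 * \<theta>" unfolding s3 using a I by (simp add: I0_def I2_def power_divide)
  also have "\<dots> = (3 * \<rho> * T) ^ 3" using \<rho> by (simp add: \<theta>_def eval_nat_numeral)
  finally have "s ^ 5 * I2 = 3 * \<rho> * T"
    using s I \<rho> T by (subst (asm) power_eq_iff_eq_base) auto
  moreover have "s ^ 3 * I0 = \<rho>" using s3 I by simp
  ultimately show ?thesis using that[OF s] by (simp add: I0_def I2_def)
qed

section \<open>Existence and uniqueness of the equilibrium\<close>

text \<open>
  The substitution \<open>v = u + s z\<close> reduces the moments to those of the standard profile.  The profile is
  even, so its first moment vanishes, and with it the cross term of \<open>\<bar>u + s z\<bar>\<^sup>2\<close>.
\<close>

lemma fermi_dirac_with_moments_exists:
  assumes e: "0 \<le> \<epsilon>" and \<rho>: "0 < \<rho>" and T: "0 < T"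
    and dense: "(\<epsilon> * \<rho> / (4 / 3 * pi))\<^sup>2 < 125 * T ^ 3"
  obtains g where "fermi_dirac \<epsilon> g" "(\<integral>v. g v \<partial>lebesgue) = \<rho>"
    "(\<integral>v. g v *\<^sub>R v \<partial>lebesgue) = \<rho> *\<^sub>R u"
    "(\<integral>v. g v * (norm v)\<^sup>2 \<partial>lebesgue) = 3 * \<rho> * T + \<rho> * (norm u)\<^sup>2"
proof -
  from fd_parameters_exist[OF assms] obtain a s where s: "0 < s"
    and m0: "s ^ 3 * fd_moment 0 \<epsilon> a = \<rho>" and m2: "s ^ 5 * fd_moment 2 \<epsilon> a = 3 * \<rho> * T" by metis
  define p where "p = fd_profile \<epsilon> a"
  have [measurable]: "p \<in> borel_measurable borel" by (simp add: p_def)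
  define g where "g v = p ((1 / s) *\<^sub>R (v - u))" for v
  have [measurable]: "g \<in> borel_measurable borel" unfolding g_def by measurable
  have gs: "g (u + s *\<^sub>R z) = p z" for z using s by (simp add: g_def)
  have p_int: "integrable lborel (\<lambda>z. p z * norm z ^ k)" if "k \<le> 2" for k
    unfolding p_def by (rule fd_profile_power_integrable[OF e that])
  have p0: "integrable lborel p" "(\<integral>z. p z \<partial>lborel) = fd_moment 0 \<epsilon> a"
    using p_int[of 0] by (simp_all add: p_def fd_moment_def)
  have p2: "integrable lborel (\<lambda>z. p z * (norm z)\<^sup>2)" "(\<integral>z. p z * (norm z)\<^sup>2 \<partial>lborel) = fd_moment 2 \<epsilon> a"
    using p_int[of 2] by (simp_all add: p_def fd_moment_def)
  have p1: "integrable lborel (\<lambda>z. p z *\<^sub>R z)"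
    by (rule Bochner_Integration.integrable_bound[OF p_int[of 1]]) (auto simp: abs_mult)
  have odd: "(\<integral>z. p z *\<^sub>R z \<partial>lborel) = 0"
  proof -
    have "(\<integral>z. p z *\<^sub>R z \<partial>lborel) = \<bar>- 1\<bar> ^ DIM(real^3) *\<^sub>R (\<integral>z. p (0 + (- 1) *\<^sub>R z) *\<^sub>R (0 + (- 1) *\<^sub>R z) \<partial>lborel)"
      by (rule lborel_integral_affine) auto
    also have "\<dots> = - (\<integral>z. p z *\<^sub>R z \<partial>lborel)" by (simp add: p_def fd_profile_def)
    finally have "(\<integral>z. p z *\<^sub>R z \<partial>lborel) + (\<integral>z. p z *\<^sub>R z \<partial>lborel) = 0"
      by (simp only: eq_neg_iff_add_eq_0)
    then have "2 *\<^sub>R (\<integral>z. p z *\<^sub>R z \<partial>lborel) = 0" by (simp only: scaleR_2)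
    then show ?thesis by (simp only: scaleR_eq_0_iff) simp
  qed
  show ?thesis
  proof (rule that[of g])
    show "fermi_dirac \<epsilon> g"
      unfolding fermi_dirac_def
    proof (intro exI conjI)
      show "- (1 / s\<^sup>2) < 0" using s by simp
      show "g = (\<lambda>v. exp (a + - (1 / s\<^sup>2) * (norm (v - u))\<^sup>2) / (1 + \<epsilon> * exp (a + - (1 / s\<^sup>2) * (norm (v - u))\<^sup>2)))"
        using s by (auto simp: g_def p_def fd_profile_def power_mult_distrib power_divide)
    qed
    have "(\<integral>v. g v \<partial>lborel) = \<bar>s\<bar> ^ DIM(real^3) *\<^sub>R (\<integral>z. g (u + s *\<^sub>R z) \<partial>lborel)"
      using s by (intro lborel_integral_affine) auto
    then show "(\<integral>v. g v \<partial>lebesgue) = \<rho>"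
      using s m0 p0 by (simp add: integral_completion gs)
    have "(\<integral>v. g v *\<^sub>R v \<partial>lborel) = \<bar>s\<bar> ^ DIM(real^3) *\<^sub>R (\<integral>z. g (u + s *\<^sub>R z) *\<^sub>R (u + s *\<^sub>R z) \<partial>lborel)"
      using s by (intro lborel_integral_affine) auto
    also have "(\<lambda>z. g (u + s *\<^sub>R z) *\<^sub>R (u + s *\<^sub>R z)) = (\<lambda>z. p z *\<^sub>R u + s *\<^sub>R (p z *\<^sub>R z))"
      by (auto simp: gs algebra_simps)
    also have "(\<integral>z. p z *\<^sub>R u + s *\<^sub>R (p z *\<^sub>R z) \<partial>lborel) = fd_moment 0 \<epsilon> a *\<^sub>R u"
      using p0 p1 odd by (simp del: scaleR_scaleR)
    finally show "(\<integral>v. g v *\<^sub>R v \<partial>lebesgue) = \<rho> *\<^sub>R u"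
      using s m0 by (simp add: integral_completion)
    have "(\<integral>v. g v * (norm v)\<^sup>2 \<partial>lborel) = \<bar>s\<bar> ^ DIM(real^3) *\<^sub>R (\<integral>z. g (u + s *\<^sub>R z) * (norm (u + s *\<^sub>R z))\<^sup>2 \<partial>lborel)"
      using s by (intro lborel_integral_affine) auto
    also have "(\<lambda>z. g (u + s *\<^sub>R z) * (norm (u + s *\<^sub>R z))\<^sup>2)
        = (\<lambda>z. (norm u)\<^sup>2 * p z + 2 * s * (u \<bullet> (p z *\<^sub>R z)) + s\<^sup>2 * (p z * (norm z)\<^sup>2))"
    proof
      fix z
      have "(norm (u + s *\<^sub>R z))\<^sup>2 = (norm u)\<^sup>2 + 2 * s * (u \<bullet> z) + s\<^sup>2 * (norm z)\<^sup>2"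
        using dot_norm[of u "s *\<^sub>R z"] by (simp add: power_mult_distrib)
      then show "g (u + s *\<^sub>R z) * (norm (u + s *\<^sub>R z))\<^sup>2
          = (norm u)\<^sup>2 * p z + 2 * s * (u \<bullet> (p z *\<^sub>R z)) + s\<^sup>2 * (p z * (norm z)\<^sup>2)"
        by (simp add: gs algebra_simps)
    qed
    also have "(\<integral>z. (norm u)\<^sup>2 * p z + 2 * s * (u \<bullet> (p z *\<^sub>R z)) + s\<^sup>2 * (p z * (norm z)\<^sup>2) \<partial>lborel)
        = (norm u)\<^sup>2 * fd_moment 0 \<epsilon> a + s\<^sup>2 * fd_moment 2 \<epsilon> a"
    proof -
      have i: "integrable lborel (\<lambda>z. u \<bullet> (p z *\<^sub>R z))" "(\<integral>z. u \<bullet> (p z *\<^sub>R z) \<partial>lborel) = 0"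
        using p1 odd by (auto simp del: inner_scaleR_right)
      show ?thesis using p0 p2 i by (simp del: inner_scaleR_right)
    qed
    finally have "(\<integral>v. g v * (norm v)\<^sup>2 \<partial>lborel) = (norm u)\<^sup>2 * (s ^ 3 * fd_moment 0 \<epsilon> a) + s ^ 5 * fd_moment 2 \<epsilon> a"
      using s by (simp add: algebra_simps eval_nat_numeral)
    then show "(\<integral>v. g v * (norm v)\<^sup>2 \<partial>lebesgue) = 3 * \<rho> * T + \<rho> * (norm u)\<^sup>2"
      unfolding m0 m2 by (simp add: integral_completion mult.commute)
  qed
qed

lemma L1_2_integrable:
  assumes "h \<in> L1_2"
  shows "integrable lebesgue h" "integrable lebesgue (\<lambda>v. h v *\<^sub>R v)" "integrable lebesgue (\<lambda>v. h v * (norm v)\<^sup>2)"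
proof -
  have [measurable]: "h \<in> borel_measurable lebesgue" and i: "integrable lebesgue (\<lambda>v. \<bar>h v\<bar> * (1 + (norm v)\<^sup>2))"
    using assms by (auto simp: L1_2_def)
  have [measurable]: "(\<lambda>v::real^3. v) \<in> borel_measurable lebesgue"
    by (rule measurable_completion) simp
  show "integrable lebesgue h"
    by (rule Bochner_Integration.integrable_bound[OF i]) (auto simp: abs_mult mult_le_cancel_left1)
  show "integrable lebesgue (\<lambda>v. h v *\<^sub>R v)"
  proof (rule Bochner_Integration.integrable_bound[OF i])
    show "AE v in lebesgue. norm (h v *\<^sub>R v) \<le> norm (\<bar>h v\<bar> * (1 + (norm v)\<^sup>2))"
      using power_le_one_plus_square[of "norm v" 1 for v :: "real^3"]
      by (intro AE_I2) (auto simp: abs_mult intro!: mult_left_mono)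
  qed measurable
  show "integrable lebesgue (\<lambda>v. h v * (norm v)\<^sup>2)"
    by (rule Bochner_Integration.integrable_bound[OF i]) (auto simp: abs_mult intro!: mult_left_mono)
qed

lemma norm_diff_square_expand:
  fixes u v :: "'a::real_inner"
  shows "(norm (v - u))\<^sup>2 = (norm v)\<^sup>2 - 2 * (u \<bullet> v) + (norm u)\<^sup>2"
  unfolding power2_norm_eq_inner inner_diff_left inner_diff_right inner_commute[of v u] by simp

lemma same_moments_quadratic_integral:
  assumes f: "f \<in> L1_2" and g: "g \<in> L1_2" and fg: "same_moments f g"
  shows "integrable lebesgue (\<lambda>v. (a + b * (norm (v - u))\<^sup>2) * (f v - g v))"
    and "(\<integral>v. (a + b * (norm (v - u))\<^sup>2) * (f v - g v) \<partial>lebesgue) = 0"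
proof -
  note F = L1_2_integrable[OF f] and G = L1_2_integrable[OF g]
  define d where "d v = f v - g v" for v
  have d: "integrable lebesgue d" "integrable lebesgue (\<lambda>v. d v *\<^sub>R v)" "integrable lebesgue (\<lambda>v. d v * (norm v)\<^sup>2)"
    unfolding d_def using F G by (auto simp: scaleR_diff_left left_diff_distrib)
  have d_eq: "(\<integral>v. d v \<partial>lebesgue) = 0" "(\<integral>v. d v *\<^sub>R v \<partial>lebesgue) = 0" "(\<integral>v. d v * (norm v)\<^sup>2 \<partial>lebesgue) = 0"
    using F G fg by (simp_all add: d_def same_moments_def scaleR_diff_left left_diff_distrib)
  have expand: "(a + b * (norm (v - u))\<^sup>2) * (f v - g v)
      = (a + b * (norm u)\<^sup>2) * d v - 2 * b * (u \<bullet> (d v *\<^sub>R v)) + b * (d v * (norm v)\<^sup>2)" for v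
    by (simp add: d_def norm_diff_square_expand algebra_simps)
  have i: "integrable lebesgue (\<lambda>v. u \<bullet> (d v *\<^sub>R v))" "(\<integral>v. u \<bullet> (d v *\<^sub>R v) \<partial>lebesgue) = 0"
    using d d_eq by (auto simp del: inner_scaleR_right)
  show "integrable lebesgue (\<lambda>v. (a + b * (norm (v - u))\<^sup>2) * (f v - g v))"
    unfolding expand using d i by (simp del: inner_scaleR_right)
  show "(\<integral>v. (a + b * (norm (v - u))\<^sup>2) * (f v - g v) \<partial>lebesgue) = 0"
    unfolding expand using d i d_eq by (simp del: inner_scaleR_right)
qed

lemma integrable_lebesgue_gaussian_weight:
  fixes u :: "real^3"
  assumes "b < 0"
  shows "integrable lebesgue (\<lambda>v. exp (a + b * (norm (v - u))\<^sup>2) * (1 + (norm v)\<^sup>2))"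
  using integrable_gaussian_weight[OF assms, of a u] by (subst integrable_completion) auto

lemma fermi_dirac_in_L1_2:
  assumes e: "0 \<le> \<epsilon>" and g: "fermi_dirac \<epsilon> g"
  shows "g \<in> L1_2"
proof -
  from g obtain a u b where b: "b < 0"
    and g_eq: "g = (\<lambda>v. exp (a + b * (norm (v - u))\<^sup>2) / (1 + \<epsilon> * exp (a + b * (norm (v - u))\<^sup>2)))"
    unfolding fermi_dirac_def by blast
  have [measurable]: "g \<in> borel_measurable borel" unfolding g_eq by measurable
  have m: "g \<in> borel_measurable lebesgue" by (rule measurable_completion) simp
  have "integrable lebesgue (\<lambda>v. \<bar>g v\<bar> * (1 + (norm v)\<^sup>2))"
  proof (rule Bochner_Integration.integrable_bound[OF integrable_lebesgue_gaussian_weight[OF b, of a u]])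
    show "(\<lambda>v. \<bar>g v\<bar> * (1 + (norm v)\<^sup>2)) \<in> borel_measurable lebesgue"
      by (rule measurable_completion) measurable
    show "AE v in lebesgue. norm (\<bar>g v\<bar> * (1 + (norm v)\<^sup>2))
        \<le> norm (exp (a + b * (norm (v - u))\<^sup>2) * (1 + (norm v)\<^sup>2))"
    proof (rule AE_I2)
      fix v
      have "0 < g v" "g v \<le> exp (a + b * (norm (v - u))\<^sup>2)"
        unfolding g_eq by (rule fermi_dirac_value_bounds[OF e])+
      then have "\<bar>g v\<bar> \<le> exp (a + b * (norm (v - u))\<^sup>2)" by simp
      then show "norm (\<bar>g v\<bar> * (1 + (norm v)\<^sup>2)) \<le> norm (exp (a + b * (norm (v - u))\<^sup>2) * (1 + (norm v)\<^sup>2))"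
        by (auto simp: abs_mult intro!: mult_right_mono)
    qed
  qed
  with m show ?thesis by (simp add: L1_2_def)
qed

lemma fermi_dirac_value_strict_mono:
  fixes p q :: real
  assumes "0 \<le> \<epsilon>" "p < q"
  shows "exp p / (1 + \<epsilon> * exp p) < exp q / (1 + \<epsilon> * exp q)"
proof -
  have "0 < 1 + \<epsilon> * exp p" "0 < 1 + \<epsilon> * exp q" using assms by (auto intro!: add_pos_nonneg)
  moreover have "exp p * (1 + \<epsilon> * exp q) < exp q * (1 + \<epsilon> * exp p)"
    using assms by (simp add: algebra_simps)
  ultimately show ?thesis by (simp add: divide_simps)
qed

text \<open>
  Let \<open>q\<close> and \<open>q'\<close> be the quadratic polynomials of \<open>g\<close> and \<open>h\<close>.  Equality of the moments makes the
  integral of \<open>(q - q') (g - h)\<close> vanish.  The integrand is nonnegative by monotonicity, so it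
  vanishes almost everywhere, hence \<open>g = h\<close> almost everywhere, and everywhere by continuity.
\<close>

lemma fermi_dirac_unique:
  assumes e: "0 \<le> \<epsilon>" and g: "fermi_dirac \<epsilon> g" and h: "fermi_dirac \<epsilon> h" and gh: "same_moments g h"
  shows "g = h"
proof -
  define S where "S q = exp q / (1 + \<epsilon> * exp q)" for q :: real
  have pos: "0 < 1 + \<epsilon> * exp q" for q :: real using e by (intro add_pos_nonneg) auto
  from g obtain a u b where g_eq: "g = (\<lambda>v. S (a + b * (norm (v - u))\<^sup>2))"
    unfolding fermi_dirac_def S_def by blast
  from h obtain a' u' b' where h_eq: "h = (\<lambda>v. S (a' + b' * (norm (v - u'))\<^sup>2))"
    unfolding fermi_dirac_def S_def by blast
  let ?q = "\<lambda>v. a + b * (norm (v - u))\<^sup>2" and ?q' = "\<lambda>v. a' + b' * (norm (v - u'))\<^sup>2"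
  note I = same_moments_quadratic_integral[OF fermi_dirac_in_L1_2[OF e g] fermi_dirac_in_L1_2[OF e h] gh]
  have int: "integrable lebesgue (\<lambda>v. (?q v - ?q' v) * (g v - h v))"
    and zero: "(\<integral>v. (?q v - ?q' v) * (g v - h v) \<partial>lebesgue) = 0"
    using I[of a b u] I[of a' b' u'] by (simp_all only: left_diff_distrib[of "?q v" "?q' v" for v]) simp_all
  have S_less: "S x < S y" if "x < y" for x y using fermi_dirac_value_strict_mono[OF e that] by (simp add: S_def)
  have S_mono: "0 < (x - y) * (S x - S y)" if "x \<noteq> y" for x y
    using that S_less[of x y] S_less[of y x] by (cases "x < y") (auto intro: mult_neg_neg)
  have nn: "0 \<le> (?q v - ?q' v) * (g v - h v)" for v
    using S_mono[of "?q v" "?q' v"] by (cases "?q v = ?q' v") (auto simp: g_eq h_eq)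
  have "AE v in lebesgue. (?q v - ?q' v) * (g v - h v) = 0"
    using int zero nn by (subst (asm) integral_nonneg_eq_0_iff_AE) auto
  then have "AE v in lebesgue. g v = h v"
  proof eventually_elim
    case (elim v)
    then show ?case using S_mono[of "?q v" "?q' v"] by (cases "?q v = ?q' v") (auto simp: g_eq h_eq)
  qed
  then have "negligible {v. g v \<noteq> h v}"
    by (simp add: completion.AE_iff_null_sets negligible_iff_null_sets)
  moreover have "open {v. g v \<noteq> h v}"
    unfolding g_eq h_eq S_def using pos
    by (intro open_Collect_neq continuous_intros) (auto simp: less_imp_neq[symmetric])
  ultimately show "g = h" using open_not_negligible by blast
qed

lemma equilibrium_properties:
  assumes e: "0 \<le> \<epsilon>" and ex: "fermi_dirac \<epsilon> g" "same_moments f g"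
  shows "fermi_dirac \<epsilon> (equilibrium \<epsilon> f)" "same_moments f (equilibrium \<epsilon> f)"
proof -
  have "\<exists>!g. fermi_dirac \<epsilon> g \<and> same_moments f g"
    using ex fermi_dirac_unique[OF e] by (auto intro!: ex1I[of _ g] simp: same_moments_def)
  from theI'[OF this] show "fermi_dirac \<epsilon> (equilibrium \<epsilon> f)" "same_moments f (equilibrium \<epsilon> f)"
    unfolding equilibrium_def by auto
qed

lemma mass_density_pos:
  assumes f: "f \<in> L1_2" and f0: "AE v in lebesgue. 0 \<le> f v" and nz: "\<not> (AE v in lebesgue. f v = 0)"
  shows "0 < mass_density f"
  using integral_nonneg_AE[OF f0] integral_nonneg_eq_0_iff_AE[OF L1_2_integrable(1)[OF f] f0] nz
  by (auto simp: mass_density_def)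

lemma temperature_pos:
  assumes f: "f \<in> L1_2" and f0: "AE v in lebesgue. 0 \<le> f v" and nz: "\<not> (AE v in lebesgue. f v = 0)"
  shows "0 < temperature f"
proof -
  note F = L1_2_integrable[OF f] and \<rho> = mass_density_pos[OF assms]
  define u where "u = mean_velocity f"
  have expand: "f v * (norm (v - u))\<^sup>2 = f v * (norm v)\<^sup>2 - 2 * (u \<bullet> (f v *\<^sub>R v)) + (norm u)\<^sup>2 * f v" for v
    by (simp add: norm_diff_square_expand algebra_simps)
  have i: "integrable lebesgue (\<lambda>v. u \<bullet> (f v *\<^sub>R v))"
    "(\<integral>v. u \<bullet> (f v *\<^sub>R v) \<partial>lebesgue) = mass_density f * (norm u)\<^sup>2"
    using F moment_equations(1)[of f] \<rho>
    by (auto simp: u_def power2_norm_eq_inner simp del: inner_scaleR_right) simp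
  have int: "integrable lebesgue (\<lambda>v. f v * (norm (v - u))\<^sup>2)"
    unfolding expand using F i by (simp del: inner_scaleR_right)
  have "(\<integral>v. f v * (norm (v - u))\<^sup>2 \<partial>lebesgue)
      = (\<integral>v. f v * (norm v)\<^sup>2 \<partial>lebesgue) - 2 * (mass_density f * (norm u)\<^sup>2) + (norm u)\<^sup>2 * (\<integral>v. f v \<partial>lebesgue)"
    unfolding expand i(2)[symmetric] using F i(1) by (simp del: inner_scaleR_right)
  also have "(\<integral>v. f v * (norm v)\<^sup>2 \<partial>lebesgue) = 3 * mass_density f * temperature f + mass_density f * (norm u)\<^sup>2"
    using moment_equations(2)[of f] \<rho> by (simp add: u_def)
  also have "(\<integral>v. f v \<partial>lebesgue) = mass_density f" by (simp add: mass_density_def)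
  finally have eq: "(\<integral>v. f v * (norm (v - u))\<^sup>2 \<partial>lebesgue) = 3 * mass_density f * temperature f" by simp
  have nn: "AE v in lebesgue. 0 \<le> f v * (norm (v - u))\<^sup>2" using f0 by eventually_elim simp
  have "(\<integral>v. f v * (norm (v - u))\<^sup>2 \<partial>lebesgue) \<noteq> 0"
  proof
    assume "(\<integral>v. f v * (norm (v - u))\<^sup>2 \<partial>lebesgue) = 0"
    with int nn have "AE v in lebesgue. f v * (norm (v - u))\<^sup>2 = 0"
      by (simp add: integral_nonneg_eq_0_iff_AE)
    moreover have "AE v in lebesgue. v \<noteq> u"
      by (rule AE_completion) (rule AE_lborel_singleton)
    ultimately have "AE v in lebesgue. f v = 0" by eventually_elim auto
    with nz show False by simp
  qed
  with integral_nonneg_AE[OF nn] have "0 < (\<integral>v. f v * (norm (v - u))\<^sup>2 \<partial>lebesgue)" by linarith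
  then have "0 < 3 * mass_density f * temperature f"
    unfolding eq .
  with \<rho> show ?thesis by (simp add: zero_less_mult_iff)
qed

text \<open>
  The condition \<open>temperature_ratio \<epsilon> f > 2/5\<close> is a lower bound for the temperature by a power
  \<open>2/3\<close>; its cube is the polynomial condition of \<open>fermi_dirac_with_moments_exists\<close>.
\<close>

lemma equilibrium_exists:
  assumes e: "0 \<le> \<epsilon>" and f: "f \<in> L1_2" "AE v in lebesgue. 0 \<le> f v" "\<not> (AE v in lebesgue. f v = 0)"
    and dense: "\<epsilon> = 0 \<or> 2 / 5 < temperature_ratio \<epsilon> f"
  shows "fermi_dirac \<epsilon> (equilibrium \<epsilon> f)" "same_moments f (equilibrium \<epsilon> f)"
proof -
  define \<rho> T where "\<rho> = mass_density f" and "T = temperature f"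
  have \<rho>: "\<rho> > 0" and T: "T > 0" using mass_density_pos[OF f] temperature_pos[OF f] by (auto simp: \<rho>_def T_def)
  define X where "X = \<epsilon> * \<rho> / (4 / 3 * pi)"
  have "X\<^sup>2 < 125 * T ^ 3"
  proof (cases "\<epsilon> = 0")
    case False
    then have X: "X > 0" using e \<rho> by (simp add: X_def)
    have "2 / 5 < T / (1 / 2 * X powr (2 / 3))"
      using dense False by (simp add: temperature_ratio_def fermi_temperature_def \<rho>_def T_def X_def mult_ac)
    then have "X powr (2 / 3) < 5 * T" using X by (simp add: field_simps)
    then have "(X powr (2 / 3)) ^ 3 < (5 * T) ^ 3" by (intro power_strict_mono) auto
    also have "(X powr (2 / 3)) ^ 3 = X\<^sup>2" using X by (simp add: powr_powr flip: powr_realpow powr_numeral)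
    finally show ?thesis by (simp add: power_mult_distrib)
  qed (use T X_def in simp)
  obtain g where g: "fermi_dirac \<epsilon> g" "(\<integral>v. g v \<partial>lebesgue) = \<rho>"
    "(\<integral>v. g v *\<^sub>R v \<partial>lebesgue) = \<rho> *\<^sub>R mean_velocity f"
    "(\<integral>v. g v * (norm v)\<^sup>2 \<partial>lebesgue) = 3 * \<rho> * T + \<rho> * (norm (mean_velocity f))\<^sup>2"
    by (rule fermi_dirac_with_moments_exists[OF e \<rho> T, of "mean_velocity f"])
       (use \<open>X\<^sup>2 < 125 * T ^ 3\<close> in \<open>auto simp: X_def\<close>)
  have "same_moments f g"
    unfolding same_moments_def using g moment_equations[of f] \<rho> by (simp add: \<rho>_def T_def mass_density_def)
  with g(1) show "fermi_dirac \<epsilon> (equilibrium \<epsilon> f)" "same_moments f (equilibrium \<epsilon> f)"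
    using equilibrium_properties[OF e] by blast+
qed

section \<open>Relative entropy\<close>

text \<open>
  The closed forms of \<open>Phi \<epsilon>\<close> hold only in the physical range, where \<open>f\<close> lies almost everywhere.
  This suffices because Lebesgue measure is complete.
\<close>

lemma Phi_compose_measurable:
  fixes f :: "real^3 \<Rightarrow> real"
  assumes e: "0 \<le> \<epsilon>" and [measurable]: "f \<in> borel_measurable lebesgue"
    and f: "AE v in lebesgue. 0 \<le> f v" "AE v in lebesgue. \<epsilon> * f v \<le> 1"
  shows "(\<lambda>v. Phi \<epsilon> (f v)) \<in> borel_measurable lebesgue"
proof (rule borel_measurable_AE)
  let ?k = "\<lambda>v. if \<epsilon> = 0 then f v * ln (f v) - f v
    else f v * ln (f v) + (1 - \<epsilon> * f v) * ln (1 - \<epsilon> * f v) / \<epsilon>"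
  show "?k \<in> borel_measurable lebesgue" by measurable
  show "AE v in lebesgue. ?k v = Phi \<epsilon> (f v)"
    using f by eventually_elim (use e in \<open>auto simp: Phi_zero_closed_form Phi_closed_form\<close>)
qed

text \<open>
  For a Fermi-Dirac distribution \<open>m\<close>, \<open>ln (phi \<epsilon> m)\<close> is the quadratic polynomial \<open>q\<close>, and the integral of
  \<open>q (f - m)\<close> vanishes.  Therefore the relative entropy is the integral of the Bregman divergence
  of \<open>Phi \<epsilon>\<close>.  When \<open>\<epsilon> > 0\<close>, the integrability of \<open>Phi \<epsilon> \<circ> f\<close> comes from its bounds: the Bregman
  inequality from below and \<open>Phi_le_linear\<close> from above.  For \<open>\<epsilon> = 0\<close> there is no such upper bound, so the
  integrability is a hypothesis.
\<close>

lemma relative_entropy_ge_xlnx: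
  assumes e: "0 \<le> \<epsilon>" and f: "f \<in> L1_2" "AE v in lebesgue. 0 \<le> f v" "AE v in lebesgue. \<epsilon> * f v \<le> 1"
    and m: "fermi_dirac \<epsilon> m" "same_moments f m"
    and fint: "\<epsilon> = 0 \<Longrightarrow> integrable lebesgue (\<lambda>v. Phi 0 (f v))"
  shows "integrable lebesgue (\<lambda>v. f v * ln (f v / m v) - f v + m v)"
    and "(\<integral>v. f v * ln (f v / m v) - f v + m v \<partial>lebesgue) \<le> relative_entropy \<epsilon> f m"
    and "\<And>v. 0 < m v"
proof -
  from m(1) obtain a u b where b: "b < 0"
    and m_eq: "m = (\<lambda>v. exp (a + b * (norm (v - u))\<^sup>2) / (1 + \<epsilon> * exp (a + b * (norm (v - u))\<^sup>2)))"
    unfolding fermi_dirac_def by blast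
  define q where "q v = a + b * (norm (v - u))\<^sup>2" for v
  have mq: "m v = exp (q v) / (1 + \<epsilon> * exp (q v))" for v by (simp add: m_eq q_def)
  note mb = fermi_dirac_value_bounds[OF e, of "q v" for v, folded mq]
  show "\<And>v. 0 < m v" by (rule mb(1))
  have mL: "m \<in> L1_2" by (rule fermi_dirac_in_L1_2[OF e m(1)])
  have [measurable]: "f \<in> borel_measurable lebesgue" "m \<in> borel_measurable lebesgue"
    using f mL by (auto simp: L1_2_def)
  note F = L1_2_integrable[OF f(1)] and M = L1_2_integrable[OF mL]
  note Q = same_moments_quadratic_integral[OF f(1) mL m(2), of a b u, folded q_def]
  have pw: "AE v in lebesgue. f v * ln (f v / m v) - f v + m v
      \<le> Phi \<epsilon> (f v) - Phi \<epsilon> (m v) - q v * (f v - m v) \<and> 0 \<le> f v * ln (f v / m v) - f v + m v"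
    using f(2,3)
  proof eventually_elim
    case (elim v)
    have "0 \<le> m v * (f v / m v * ln (f v / m v) - f v / m v + 1)"
      using elim mb(1)[of v] by (intro mult_nonneg_nonneg xlnx_bregman_nonneg) auto
    also have "\<dots> = f v * ln (f v / m v) - f v + m v"
      using mb(1)[of v] by (simp add: algebra_simps)
    finally show ?case using Bregman_Phi_ge_xlnx[OF e elim mb(1,2), of v] unfolding mb(4) by simp
  qed
  have qm: "integrable lebesgue (\<lambda>v. m v * q v)"
  proof -
    have "(\<lambda>v. m v * q v) = (\<lambda>v. (a + b * (norm u)\<^sup>2) * m v - 2 * b * (u \<bullet> (m v *\<^sub>R v)) + b * (m v * (norm v)\<^sup>2))"
      by (auto simp: q_def norm_diff_square_expand algebra_simps)
    moreover have "integrable lebesgue (\<lambda>v. u \<bullet> (m v *\<^sub>R v))" using M by (simp del: inner_scaleR_right)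
    ultimately show ?thesis using M by (simp del: inner_scaleR_right)
  qed
  have eq: "integrable lebesgue (\<lambda>v. exp (q v))"
  proof (rule Bochner_Integration.integrable_bound[OF integrable_lebesgue_gaussian_weight[OF b, of a u]])
    show "(\<lambda>v. exp (q v)) \<in> borel_measurable lebesgue"
      unfolding q_def by (rule measurable_completion) measurable
  qed (auto simp: q_def)
  have Pm: "integrable lebesgue (\<lambda>v. Phi \<epsilon> (m v))"
  proof (rule Bochner_Integration.integrable_bound)
    show "integrable lebesgue (\<lambda>v. \<bar>m v * q v\<bar> + exp (q v))" using qm eq by simp
    show "(\<lambda>v. Phi \<epsilon> (m v)) \<in> borel_measurable lebesgue"
      using mb(1,2) by (intro Phi_compose_measurable e AE_I2) (auto intro: less_imp_le)
    show "AE v in lebesgue. norm (Phi \<epsilon> (m v)) \<le> norm (\<bar>m v * q v\<bar> + exp (q v))"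
    proof (rule AE_I2)
      fix v
      show "norm (Phi \<epsilon> (m v)) \<le> norm (\<bar>m v * q v\<bar> + exp (q v))"
        using Phi_fermi_dirac_value_bounds[OF e, of "q v", folded mq] by (auto simp: abs_if)
    qed
  qed
  have Pf: "integrable lebesgue (\<lambda>v. Phi \<epsilon> (f v))"
  proof (cases "\<epsilon> = 0")
    case False
    with e have e0: "\<epsilon> > 0" by simp
    show ?thesis
    proof (rule Bochner_Integration.integrable_bound)
      show "integrable lebesgue (\<lambda>v. \<bar>Phi \<epsilon> (m v) + q v * (f v - m v)\<bar> + \<bar>f v * ln (1 / \<epsilon>)\<bar>)"
        using Pm Q(1) F(1) by simp
      show "(\<lambda>v. Phi \<epsilon> (f v)) \<in> borel_measurable lebesgue"
        using f by (intro Phi_compose_measurable e) auto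
      show "AE v in lebesgue. norm (Phi \<epsilon> (f v))
          \<le> norm (\<bar>Phi \<epsilon> (m v) + q v * (f v - m v)\<bar> + \<bar>f v * ln (1 / \<epsilon>)\<bar>)"
        using pw f(2,3)
      proof eventually_elim
        case (elim v)
        then have "Phi \<epsilon> (m v) + q v * (f v - m v) \<le> Phi \<epsilon> (f v)" by linarith
        with Phi_le_linear[OF e0 elim(2,3)]
        have "\<bar>Phi \<epsilon> (f v)\<bar> \<le> \<bar>Phi \<epsilon> (m v) + q v * (f v - m v)\<bar> + \<bar>f v * ln (1 / \<epsilon>)\<bar>"
          by linarith
        then show ?case by simp
      qed
    qed
  qed (use fint in simp)
  have B: "integrable lebesgue (\<lambda>v. Phi \<epsilon> (f v) - Phi \<epsilon> (m v) - q v * (f v - m v))"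
    using Pf Pm Q(1) by simp
  show I: "integrable lebesgue (\<lambda>v. f v * ln (f v / m v) - f v + m v)"
  proof (rule Bochner_Integration.integrable_bound[OF B])
    show "AE v in lebesgue. norm (f v * ln (f v / m v) - f v + m v)
        \<le> norm (Phi \<epsilon> (f v) - Phi \<epsilon> (m v) - q v * (f v - m v))"
      using pw by eventually_elim simp
  qed measurable
  have "(\<integral>v. f v * ln (f v / m v) - f v + m v \<partial>lebesgue)
      \<le> (\<integral>v. Phi \<epsilon> (f v) - Phi \<epsilon> (m v) - q v * (f v - m v) \<partial>lebesgue)"
  proof (rule integral_mono_AE[OF I B])
    show "AE v in lebesgue. f v * ln (f v / m v) - f v + m v
        \<le> Phi \<epsilon> (f v) - Phi \<epsilon> (m v) - q v * (f v - m v)"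
      using pw by eventually_elim simp
  qed
  also have "\<dots> = relative_entropy \<epsilon> f m"
    using Pf Pm Q by (simp add: relative_entropy_def quantum_entropy_def)
  finally show "(\<integral>v. f v * ln (f v / m v) - f v + m v \<partial>lebesgue) \<le> relative_entropy \<epsilon> f m" .
qed

lemma weighted_Lr_relative_entropy_bound:
  fixes \<omega> :: "real^3 \<Rightarrow> real" and r :: real
  assumes r: "1 \<le> r" "r \<le> 2" and w: "\<And>v. 0 \<le> \<omega> v"
    and e: "0 \<le> \<epsilon>" and f: "f \<in> L1_2" "AE v in lebesgue. 0 \<le> f v" "AE v in lebesgue. \<epsilon> * f v \<le> 1"
    and m: "fermi_dirac \<epsilon> m" "same_moments f m"
    and fint: "\<epsilon> = 0 \<Longrightarrow> integrable lebesgue (\<lambda>v. Phi 0 (f v))"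
    and fin: "(\<lambda>v. (f v - m v) * \<omega> v) \<in> Lp_space (ennreal r) lebesgue"
      "(\<lambda>v. m v * (\<omega> v)\<^sup>2) \<in> Lp_space (weight_exponent r) lebesgue"
      "(\<lambda>v. f v * (\<omega> v)\<^sup>2) \<in> Lp_space (weight_exponent r) lebesgue"
  shows "(Lp_norm (ennreal r) lebesgue (\<lambda>v. (f v - m v) * \<omega> v))\<^sup>2
        \<le> Lp_norm (weight_exponent r) lebesgue (\<lambda>v. m v * (\<omega> v)\<^sup>2)
          * Lambda (Lp_norm (weight_exponent r) lebesgue (\<lambda>v. f v * (\<omega> v)\<^sup>2)
                    / Lp_norm (weight_exponent r) lebesgue (\<lambda>v. m v * (\<omega> v)\<^sup>2))
          * relative_entropy \<epsilon> f m"
proof -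
  note R = relative_entropy_ge_xlnx[OF e f m fint]
  note W = weighted_Lr_entropy_bound[OF r f(2) AE_I2[OF R(3)] w fin R(1)]
  also note mult_left_mono[OF R(2)]
  finally show ?thesis
    by (simp add: Lp_norm_nonneg Lambda_pos less_imp_le)
qed

theorem proposition10:
  fixes \<omega> :: "real^3 \<Rightarrow> real" and r :: real
  assumes "\<omega> \<in> borel_measurable lebesgue"
    and "\<And>v. 0 \<le> \<omega> v"
    and "1 \<le> r" and "r \<le> 2"
  shows
    "(\<forall>f. f \<in> L1_2 \<inter> LlogL \<and> (AE v in lebesgue. 0 \<le> f v) \<and> \<not> (AE v in lebesgue. f v = 0)
        \<and> (\<lambda>v. (f v - maxwellian f v) * \<omega> v) \<in> Lp_space (ennreal r) lebesgue
        \<and> (\<lambda>v. maxwellian f v * (\<omega> v)\<^sup>2) \<in> Lp_space (weight_exponent r) lebesgue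
        \<and> (\<lambda>v. f v * (\<omega> v)\<^sup>2) \<in> Lp_space (weight_exponent r) lebesgue
      \<longrightarrow> (Lp_norm (ennreal r) lebesgue (\<lambda>v. (f v - maxwellian f v) * \<omega> v))\<^sup>2
        \<le> Lp_norm (weight_exponent r) lebesgue (\<lambda>v. maxwellian f v * (\<omega> v)\<^sup>2)
          * Lambda (Lp_norm (weight_exponent r) lebesgue (\<lambda>v. f v * (\<omega> v)\<^sup>2)
                    / Lp_norm (weight_exponent r) lebesgue (\<lambda>v. maxwellian f v * (\<omega> v)\<^sup>2))
          * relative_entropy 0 f (maxwellian f))
     \<and>
     (\<forall>\<epsilon> f. 0 < \<epsilon> \<and> f \<in> L1_2 \<and> (AE v in lebesgue. 0 \<le> f v) \<and> \<not> (AE v in lebesgue. f v = 0)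
        \<and> (AE v in lebesgue. 0 \<le> 1 - \<epsilon> * f v) \<and> 2 / 5 < temperature_ratio \<epsilon> f
        \<and> (\<lambda>v. (f v - equilibrium \<epsilon> f v) * \<omega> v) \<in> Lp_space (ennreal r) lebesgue
        \<and> (\<lambda>v. equilibrium \<epsilon> f v * (\<omega> v)\<^sup>2) \<in> Lp_space (weight_exponent r) lebesgue
        \<and> (\<lambda>v. f v * (\<omega> v)\<^sup>2) \<in> Lp_space (weight_exponent r) lebesgue
      \<longrightarrow> (Lp_norm (ennreal r) lebesgue (\<lambda>v. (f v - equilibrium \<epsilon> f v) * \<omega> v))\<^sup>2
        \<le> Lp_norm (weight_exponent r) lebesgue (\<lambda>v. equilibrium \<epsilon> f v * (\<omega> v)\<^sup>2)
          * Lambda (Lp_norm (weight_exponent r) lebesgue (\<lambda>v. f v * (\<omega> v)\<^sup>2)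
                    / Lp_norm (weight_exponent r) lebesgue (\<lambda>v. equilibrium \<epsilon> f v * (\<omega> v)\<^sup>2))
          * relative_entropy \<epsilon> f (equilibrium \<epsilon> f))"
proof (intro conjI allI impI; elim conjE)
  fix f :: "real^3 \<Rightarrow> real"
  assume fL: "f \<in> L1_2 \<inter> LlogL" and f0: "AE v in lebesgue. 0 \<le> f v" and nz: "\<not> (AE v in lebesgue. f v = 0)"
    and fin: "(\<lambda>v. (f v - maxwellian f v) * \<omega> v) \<in> Lp_space (ennreal r) lebesgue"
      "(\<lambda>v. maxwellian f v * (\<omega> v)\<^sup>2) \<in> Lp_space (weight_exponent r) lebesgue"
      "(\<lambda>v. f v * (\<omega> v)\<^sup>2) \<in> Lp_space (weight_exponent r) lebesgue"
  have f: "f \<in> L1_2" and ll: "integrable lebesgue (\<lambda>v. f v * ln \<bar>f v\<bar>)" using fL by (auto simp: LlogL_def)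
  have f1: "AE v in lebesgue. 0 * f v \<le> 1" by simp
  have [measurable]: "f \<in> borel_measurable lebesgue" using f by (simp add: L1_2_def)
  have "integrable lebesgue (\<lambda>v. Phi 0 (f v))"
  proof (rule integrable_cong_AE_imp)
    show "integrable lebesgue (\<lambda>v. f v * ln \<bar>f v\<bar> - f v)" using ll L1_2_integrable(1)[OF f] by simp
    show "(\<lambda>v. Phi 0 (f v)) \<in> borel_measurable lebesgue" by (rule Phi_compose_measurable[OF _ _ f0 f1]) auto
    show "AE v in lebesgue. f v * ln \<bar>f v\<bar> - f v = Phi 0 (f v)"
      using f0 by eventually_elim (simp add: Phi_zero_closed_form)
  qed
  with equilibrium_exists[OF _ f f0 nz, of 0] assms(2-4) f f0 f1 fin
  show "(Lp_norm (ennreal r) lebesgue (\<lambda>v. (f v - maxwellian f v) * \<omega> v))\<^sup>2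
        \<le> Lp_norm (weight_exponent r) lebesgue (\<lambda>v. maxwellian f v * (\<omega> v)\<^sup>2)
          * Lambda (Lp_norm (weight_exponent r) lebesgue (\<lambda>v. f v * (\<omega> v)\<^sup>2)
                    / Lp_norm (weight_exponent r) lebesgue (\<lambda>v. maxwellian f v * (\<omega> v)\<^sup>2))
          * relative_entropy 0 f (maxwellian f)"
    by (intro weighted_Lr_relative_entropy_bound) auto
next
  fix \<epsilon> :: real and f :: "real^3 \<Rightarrow> real"
  assume e: "0 < \<epsilon>" and f: "f \<in> L1_2" and f0: "AE v in lebesgue. 0 \<le> f v" and nz: "\<not> (AE v in lebesgue. f v = 0)"
    and f1: "AE v in lebesgue. 0 \<le> 1 - \<epsilon> * f v" and ratio: "2 / 5 < temperature_ratio \<epsilon> f"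
    and fin: "(\<lambda>v. (f v - equilibrium \<epsilon> f v) * \<omega> v) \<in> Lp_space (ennreal r) lebesgue"
      "(\<lambda>v. equilibrium \<epsilon> f v * (\<omega> v)\<^sup>2) \<in> Lp_space (weight_exponent r) lebesgue"
      "(\<lambda>v. f v * (\<omega> v)\<^sup>2) \<in> Lp_space (weight_exponent r) lebesgue"
  from equilibrium_exists[OF _ f f0 nz, of \<epsilon>] e ratio assms(2-4) f f0 f1 fin
  show "(Lp_norm (ennreal r) lebesgue (\<lambda>v. (f v - equilibrium \<epsilon> f v) * \<omega> v))\<^sup>2
        \<le> Lp_norm (weight_exponent r) lebesgue (\<lambda>v. equilibrium \<epsilon> f v * (\<omega> v)\<^sup>2)
          * Lambda (Lp_norm (weight_exponent r) lebesgue (\<lambda>v. f v * (\<omega> v)\<^sup>2)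
                    / Lp_norm (weight_exponent r) lebesgue (\<lambda>v. equilibrium \<epsilon> f v * (\<omega> v)\<^sup>2))
          * relative_entropy \<epsilon> f (equilibrium \<epsilon> f)"
    by (intro weighted_Lr_relative_entropy_bound) auto
qed

end
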